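(* Let $\Gamma$ be a uniform triangulation of the $(n-1)$-dimensional simplex $\sigma_n=2^V$, with associated $f$-triangle $\mathcal{F}$, and let $\mathcal{H}^\circ_\mathcal{F}:\mathbb{R}_n[x]\to\mathbb{R}_n[x]$ be the associated linear map. (a) If $\Gamma$ is theta unimodal, then $\mathcal{H}^\circ_\mathcal{F}(p(x))$ has a unimodal symmetric decomposition with respect to $n$ for every $p(x)\in\mathcal{P}_n[x]$. (b) If $\Gamma$ is theta $\gamma$-positive, then $\mathcal{H}^\circ_\mathcal{F}(p(x))$ has a $\gamma$-positive symmetric decomposition with respect to $n$ for every $p(x)\in\mathcal{P}_n[x]$.
   Context: $V$ is an $n$-element set and $\sigma_n=2^V$ the simplex on $V$. A triangulation $\Gamma$ of $2^V$ is a simplicial complex admitting a geometric realization that geometrically subdivides a geometric realization of the simplex; for $F\subseteq V$, $\Gamma_F$ denotes the restriction of $\Gamma$ to the face $F$ (a triangulation of $2^F$), and $\partial\Gamma_F$ the restriction of $\Gamma_F$ to the boundary complex of $2^F$. For a simplicial complex $\Delta$ of dimension $d-1$, its $h$-polynomial is $h(\Delta,x)=\sum_{i=0}^{d} f_{i-1}(\Delta)x^i(1-x)^{d-i}$, where $f_{i-1}(\Delta)$ is the number of $(i-1)$-dimensional faces (with $f_{-1}=1$ for the empty face). $\Gamma$ is uniform with $f$-triangle $\mathcal{F}=(f_\mathcal{F}(i,j))_{0\le i\le j\le n}$ if for all $0\le i\le j\le n$, the restriction of $\Gamma$ to any $(j-1)$-dimensional face of $\sigma_n$ has exactly $f_\mathcal{F}(i,j)$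 faces of dimension $i-1$. Then $h_\mathcal{F}(\sigma_m,x)$ denotes $h(\Gamma_F,x)$ for any $F\subseteq V$ with $|F|=m$, and $\mathcal{H}^\circ_\mathcal{F}$ is the linear map on $\mathbb{R}_n[x]$ (polynomials of degree at most $n$) with $\mathcal{H}^\circ_\mathcal{F}(x^m)=x^m h_\mathcal{F}(\sigma_m,1/x)$ for $m=0,1,\dots,n$. For $F\subseteq V$ let $\theta(\Gamma_F,x)=h(\Gamma_F,x)-h(\partial\Gamma_F,x)$ (with $\theta(\Gamma_\varnothing,x)=1$). $\Gamma$ is theta unimodal (resp. theta $\gamma$-positive) if $\theta(\Gamma_F,x)$ is unimodal (resp. $\gamma$-positive with center $|F|/2$) for every $F\subseteq V$. $\mathcal{P}_n[x]$ is the set of polynomials $\sum_{k=0}^n c_kx^{n-k}(1+x)^k$ with all $c_k\ge0$. A polynomial $a(x)=\sum a_ix^i$ is unimodal if $0\le a_0\le\cdots\le a_k\ge\cdots\ge 0$ for some $k$; $\gamma$-positive with center $m/2$ if $a(x)=\sum_{i=0}^{\lfloor m/2\rfloor}\gamma_ix^i(1+x)^{m-2i}$ with $\gamma_i\ge0$. Every $p\in\mathbb{R}_n[x]$ is uniquely $p(x)=a(x)+xb(x)$ with $a\in\mathbb{R}_n[x]$ symmetric with center $n/2$ (coefficients $a_i=a_{n-i}$) and $b\in\mathbb{R}_{n-1}[x]$ symmetric with center $(n-1)/2$; this symmetric decomposition with respect to $n$ is unimodal (resp. $\gamma$-positive) if both $a$ and $b$ are unimodal (resp. $\gamma$-positive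 with centers $n/2$ and $(n-1)/2$). *)

theory Defs
  imports "HOL-Analysis.Analysis" "HOL-Computational_Algebra.Polynomial"
begin

section \<open>Simplicial complexes and triangulations of the simplex\<close>

definition abstract_complex :: "'a set set \<Rightarrow> bool" where
  "abstract_complex \<Delta> \<longleftrightarrow>
     finite \<Delta> \<and> {} \<in> \<Delta> \<and> (\<forall>G\<in>\<Delta>. finite G \<and> (\<forall>H. H \<subseteq> G \<longrightarrow> H \<in> \<Delta>))"

text \<open>The map \<open>r\<close> places the vertices of the complex in a Euclidean space; the face \<open>G\<close> is
  realized by the simplex \<open>convex hull (r ` G)\<close>.\<close>

definition geometric_realization :: "'a set set \<Rightarrow> ('a \<Rightarrow> 'e::euclidean_space) \<Rightarrow> bool" where
  "geometric_realization \<Delta> r \<longleftrightarrow>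
     abstract_complex \<Delta> \<and>
     (\<forall>G\<in>\<Delta>. inj_on r G \<and> \<not> affine_dependent (r ` G)) \<and>
     (\<forall>G\<in>\<Delta>. \<forall>H\<in>\<Delta>. convex hull (r ` G) \<inter> convex hull (r ` H) = convex hull (r ` (G \<inter> H)))"

definition geometrically_subdivides ::
  "'b set set \<Rightarrow> ('b \<Rightarrow> 'e::euclidean_space) \<Rightarrow> 'a set set \<Rightarrow> ('a \<Rightarrow> 'e) \<Rightarrow> bool" where
  "geometrically_subdivides \<Gamma> r \<Delta> s \<longleftrightarrow>
     (\<forall>G\<in>\<Gamma>. \<exists>F\<in>\<Delta>. convex hull (r ` G) \<subseteq> convex hull (s ` F)) \<and>
     (\<Union>G\<in>\<Gamma>. convex hull (r ` G)) = (\<Union>F\<in>\<Delta>. convex hull (s ` F))"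

text \<open>The realizations \<open>s\<close> of the simplex and \<open>r\<close> of the triangulation are kept as data, since
  the restrictions of a triangulation to the faces of the simplex depend on them.\<close>

definition triangulation_of_simplex ::
  "'a set \<Rightarrow> ('a \<Rightarrow> 'e::euclidean_space) \<Rightarrow> 'b set set \<Rightarrow> ('b \<Rightarrow> 'e) \<Rightarrow> bool" where
  "triangulation_of_simplex V s \<Gamma> r \<longleftrightarrow>
     geometric_realization (Pow V) s \<and> geometric_realization \<Gamma> r \<and>
     geometrically_subdivides \<Gamma> r (Pow V) s"

definition restriction ::
  "('a \<Rightarrow> 'e::euclidean_space) \<Rightarrow> 'b set set \<Rightarrow> ('b \<Rightarrow> 'e) \<Rightarrow> 'a set \<Rightarrow> 'b set set" where
  "restriction s \<Gamma> r F = {G\<in>\<Gamma>. convex hull (r ` G) \<subseteq> convex hull (s ` F)}"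

definition boundary_restriction ::
  "('a \<Rightarrow> 'e::euclidean_space) \<Rightarrow> 'b set set \<Rightarrow> ('b \<Rightarrow> 'e) \<Rightarrow> 'a set \<Rightarrow> 'b set set" where
  "boundary_restriction s \<Gamma> r F = (\<Union>E\<in>{E. E \<subset> F}. restriction s \<Gamma> r E)"


section \<open>Face numbers, h-polynomials and theta polynomials\<close>

text \<open>\<open>face_number \<Delta> i\<close> is the number of faces with \<open>i\<close> vertices, i.e. of dimension \<open>i - 1\<close>.\<close>

definition face_number :: "'a set set \<Rightarrow> nat \<Rightarrow> nat" where
  "face_number \<Delta> i = card {G\<in>\<Delta>. card G = i}"

text \<open>In the following, \<open>d\<close> is the dimension of \<open>\<Delta>\<close> plus one.\<close>

definition h_poly :: "'a set set \<Rightarrow> real poly" where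
  "h_poly \<Delta> = (let d = Max (card ` \<Delta>) in
     \<Sum>i\<le>d. smult (real (face_number \<Delta> i)) (monom 1 i * [:1, -1:] ^ (d - i)))"

definition theta_poly ::
  "('a \<Rightarrow> 'e::euclidean_space) \<Rightarrow> 'b set set \<Rightarrow> ('b \<Rightarrow> 'e) \<Rightarrow> 'a set \<Rightarrow> real poly" where
  "theta_poly s \<Gamma> r F =
     (if F = {} then 1
      else h_poly (restriction s \<Gamma> r F) - h_poly (boundary_restriction s \<Gamma> r F))"


section \<open>Unimodality, gamma-positivity and symmetric decompositions\<close>

definition unimodal :: "real poly \<Rightarrow> bool" where
  "unimodal a \<longleftrightarrow> (\<forall>i. 0 \<le> coeff a i) \<and>
     (\<exists>k. (\<forall>i<k. coeff a i \<le> coeff a (Suc i)) \<and> (\<forall>i\<ge>k. coeff a (Suc i) \<le> coeff a i))"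

text \<open>The center is \<open>m / 2\<close>.\<close>

definition gamma_positive :: "nat \<Rightarrow> real poly \<Rightarrow> bool" where
  "gamma_positive m a \<longleftrightarrow> (\<exists>\<gamma>. (\<forall>i\<le>m div 2. 0 \<le> \<gamma> i) \<and>
     a = (\<Sum>i\<le>m div 2. smult (\<gamma> i) (monom 1 i * [:1, 1:] ^ (m - 2 * i))))"

definition symmetric_poly :: "nat \<Rightarrow> real poly \<Rightarrow> bool" where
  "symmetric_poly m a \<longleftrightarrow> degree a \<le> m \<and> (\<forall>i\<le>m. coeff a i = coeff a (m - i))"

text \<open>For \<open>n = 0\<close> the space of polynomials of degree at most \<open>n - 1\<close> is zero.\<close>

definition symmetric_decomposition :: "nat \<Rightarrow> real poly \<Rightarrow> real poly \<Rightarrow> real poly \<Rightarrow> bool" where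
  "symmetric_decomposition n p a b \<longleftrightarrow>
     p = a + monom 1 1 * b \<and> symmetric_poly n a \<and>
     (if n = 0 then b = 0 else symmetric_poly (n - 1) b)"

definition has_unimodal_symmetric_decomposition :: "nat \<Rightarrow> real poly \<Rightarrow> bool" where
  "has_unimodal_symmetric_decomposition n p \<longleftrightarrow>
     (\<exists>a b. symmetric_decomposition n p a b \<and> unimodal a \<and> unimodal b)"

definition has_gamma_positive_symmetric_decomposition :: "nat \<Rightarrow> real poly \<Rightarrow> bool" where
  "has_gamma_positive_symmetric_decomposition n p \<longleftrightarrow>
     (\<exists>a b. symmetric_decomposition n p a b \<and> gamma_positive n a \<and> gamma_positive (n - 1) b)"

definition P_polys :: "nat \<Rightarrow> real poly set" where
  "P_polys n = {p. \<exists>c. (\<forall>k\<le>n. 0 \<le> c k) \<and>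
     p = (\<Sum>k\<le>n. smult (c k) (monom 1 (n - k) * [:1, 1:] ^ k))}"

definition theta_unimodal ::
  "'a set \<Rightarrow> ('a \<Rightarrow> 'e::euclidean_space) \<Rightarrow> 'b set set \<Rightarrow> ('b \<Rightarrow> 'e) \<Rightarrow> bool" where
  "theta_unimodal V s \<Gamma> r \<longleftrightarrow> (\<forall>F\<subseteq>V. unimodal (theta_poly s \<Gamma> r F))"

definition theta_gamma_positive ::
  "'a set \<Rightarrow> ('a \<Rightarrow> 'e::euclidean_space) \<Rightarrow> 'b set set \<Rightarrow> ('b \<Rightarrow> 'e) \<Rightarrow> bool" where
  "theta_gamma_positive V s \<Gamma> r \<longleftrightarrow> (\<forall>F\<subseteq>V. gamma_positive (card F) (theta_poly s \<Gamma> r F))"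


section \<open>Uniform triangulations and the associated linear map\<close>

definition uniform_with_f_triangle ::
  "'a set \<Rightarrow> ('a \<Rightarrow> 'e::euclidean_space) \<Rightarrow> 'b set set \<Rightarrow> ('b \<Rightarrow> 'e)
    \<Rightarrow> (nat \<Rightarrow> nat \<Rightarrow> nat) \<Rightarrow> bool" where
  "uniform_with_f_triangle V s \<Gamma> r f \<longleftrightarrow>
     (\<forall>i j. i \<le> j \<and> j \<le> card V \<longrightarrow>
       (\<forall>F\<subseteq>V. card F = j \<longrightarrow> face_number (restriction s \<Gamma> r F) i = f i j))"

text \<open>The common h-polynomial of the restrictions to the faces with \<open>m\<close> vertices; see
  \<open>h_simplex_eq\<close> below.\<close>

definition h_simplex ::
  "'a set \<Rightarrow> ('a \<Rightarrow> 'e::euclidean_space) \<Rightarrow> 'b set set \<Rightarrow> ('b \<Rightarrow> 'e) \<Rightarrow> nat \<Rightarrow> real poly" where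
  "h_simplex V s \<Gamma> r m =
     (THE q. \<forall>F\<subseteq>V. card F = m \<longrightarrow> h_poly (restriction s \<Gamma> r F) = q)"

text \<open>For a polynomial \<open>p(x)\<close> of degree at most \<open>m\<close>, the following is \<open>x\<^sup>m p(1/x)\<close>.\<close>

definition reverse_poly :: "nat \<Rightarrow> real poly \<Rightarrow> real poly" where
  "reverse_poly m p = (\<Sum>i\<le>m. monom (coeff p i) (m - i))"

text \<open>The linear map sending \<open>x\<^sup>m\<close> to \<open>x\<^sup>m h(\<sigma>\<^sub>m, 1/x)\<close> for \<open>m \<le> card V\<close>; only its values on
  polynomials of degree at most \<open>card V\<close> are meaningful.\<close>

definition H_circ ::
  "'a set \<Rightarrow> ('a \<Rightarrow> 'e::euclidean_space) \<Rightarrow> 'b set set \<Rightarrow> ('b \<Rightarrow> 'e) \<Rightarrow> real poly \<Rightarrow> real poly" where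
  "H_circ V s \<Gamma> r p =
     (\<Sum>m\<le>card V. smult (coeff p m) (reverse_poly m (h_simplex V s \<Gamma> r m)))"

lemma poly_reverse_poly:
  assumes "degree p \<le> m" "x \<noteq> 0"
  shows "poly (reverse_poly m p) x = x ^ m * poly p (1 / x)"
proof -
  have "poly p (1 / x) = (\<Sum>i\<le>m. coeff p i * (1 / x) ^ i)"
    unfolding poly_altdef using assms(1)
    by (intro sum.mono_neutral_left) (auto simp: coeff_eq_0)
  moreover have "x ^ (m - i) = x ^ m * (1 / x) ^ i" if "i \<le> m" for i
    using that assms(2) by (simp add: power_diff power_one_over)
  ultimately show ?thesis
    by (simp add: reverse_poly_def poly_sum poly_monom sum_distrib_left mult_ac)
qed

lemma card_face_restriction_le:
  assumes "triangulation_of_simplex V s \<Gamma> r" "F \<subseteq> V" "G \<in> restriction s \<Gamma> r F"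
  shows "card G \<le> card F"
proof -
  have G: "inj_on r G" "\<not> affine_dependent (r ` G)"
    and F: "inj_on s F" "\<not> affine_dependent (s ` F)"
    using assms
    unfolding triangulation_of_simplex_def geometric_realization_def restriction_def by auto
  have "aff_dim (convex hull (r ` G)) \<le> aff_dim (convex hull (s ` F))"
    using assms(3) by (intro aff_dim_subset) (auto simp: restriction_def)
  then have "card (r ` G) \<le> card (s ` F)"
    using aff_dim_affine_independent[OF G(2)] aff_dim_affine_independent[OF F(2)]
    by (simp add: aff_dim_convex_hull)
  then show ?thesis
    using G(1) F(1) by (simp add: card_image)
qed

lemma face_number_restriction_eq:
  assumes "triangulation_of_simplex V s \<Gamma> r" "uniform_with_f_triangle V s \<Gamma> r f"
    and "F \<subseteq> V" "E \<subseteq> V" "card F = card E"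
  shows "face_number (restriction s \<Gamma> r F) i = face_number (restriction s \<Gamma> r E) i"
proof (cases "i \<le> card E")
  case True
  have "finite (Pow V)"
    using assms(1)
    unfolding triangulation_of_simplex_def geometric_realization_def abstract_complex_def by blast
  then have "card E \<le> card V"
    using assms(4) by (simp add: card_mono)
  then show ?thesis
    using True assms(2-5) unfolding uniform_with_f_triangle_def by simp
next
  case False
  have "{G \<in> restriction s \<Gamma> r F. card G = i} = {}" "{G \<in> restriction s \<Gamma> r E. card G = i} = {}"
    using False card_face_restriction_le[OF assms(1,3)] card_face_restriction_le[OF assms(1,4)]
      assms(5) by auto
  then show ?thesis
    by (simp only: face_number_def)
qed

lemma card_image_eq_face_number:
  assumes "finite \<Delta>"
  shows "card ` \<Delta> = {i. face_number \<Delta> i \<noteq> 0}"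
  using assms by (auto simp: face_number_def card_eq_0_iff)

lemma h_simplex_eq:
  assumes "triangulation_of_simplex V s \<Gamma> r" "uniform_with_f_triangle V s \<Gamma> r f" "F \<subseteq> V"
  shows "h_simplex V s \<Gamma> r (card F) = h_poly (restriction s \<Gamma> r F)"
proof -
  have fin: "finite (restriction s \<Gamma> r E)" for E
    using assms(1) unfolding triangulation_of_simplex_def geometric_realization_def
      abstract_complex_def restriction_def by auto
  have "h_poly (restriction s \<Gamma> r E) = h_poly (restriction s \<Gamma> r F)"
    if "E \<subseteq> V" "card E = card F" for E
  proof -
    have "face_number (restriction s \<Gamma> r E) = face_number (restriction s \<Gamma> r F)"
      using face_number_restriction_eq[OF assms(1,2) that(1) assms(3) that(2)] by blast
    then show ?thesis
      by (simp add: h_poly_def card_image_eq_face_number[OF fin])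
  qed
  then show ?thesis
    unfolding h_simplex_def using assms(3) by (intro the_equality) blast+
qed

lemma H_circ_add: "H_circ V s \<Gamma> r (p + q) = H_circ V s \<Gamma> r p + H_circ V s \<Gamma> r q"
  by (simp add: H_circ_def smult_add_left sum.distrib)

lemma H_circ_smult: "H_circ V s \<Gamma> r (smult c p) = smult c (H_circ V s \<Gamma> r p)"
  by (rule poly_eqI) (simp add: H_circ_def coeff_sum sum_distrib_left mult.assoc)

lemma H_circ_monom:
  assumes "m \<le> card V"
  shows "H_circ V s \<Gamma> r (monom 1 m) = reverse_poly m (h_simplex V s \<Gamma> r m)"
proof -
  have "H_circ V s \<Gamma> r (monom 1 m) =
      (\<Sum>k\<le>card V. if k = m then reverse_poly k (h_simplex V s \<Gamma> r k) else 0)"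
    unfolding H_circ_def by (intro sum.cong) auto
  then show ?thesis
    using assms by simp
qed

end

theory Submission
  imports Defs
begin

text \<open>
  For a face \<open>F\<close> with \<open>m\<close> vertices let \<open>g\<^sub>m = x\<^sup>m h(\<Gamma>\<^sub>F, 1/x)\<close>. The Euler characteristic of the
  open star of each face, intersected with the relative interior of \<open>F\<close>, shows that \<open>g\<^sub>m\<close> is the
  h-polynomial of the interior faces of \<open>\<Gamma>\<^sub>F\<close>. Hence
  \<open>\<theta>\<^sub>m = g\<^sub>m - x \<Sum>\<^sub>k\<^sub><\<^sub>m (m choose k) (1 - x)\<^sup>m\<^sup>-\<^sup>1\<^sup>-\<^sup>k g\<^sub>k\<close>, and \<open>\<theta>\<^sub>m\<close> is symmetric with center \<open>m/2\<close>.
  In exponential generating functions in \<open>t\<close> this reads \<open>G = \<Theta> C\<close>, where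
  \<open>C = (1 - x) / (1 - x e\<^sup>(\<^sup>1\<^sup>-\<^sup>x\<^sup>)\<^sup>t)\<close> is the Eulerian series, and the image of \<open>x\<^sup>u (1 + x)\<^sup>v\<close> is
  \<open>v!\<close> times the coefficient of \<open>t\<^sup>v\<close> in \<open>e\<^sup>t G\<^sup>(\<^sup>u\<^sup>)\<close>. With \<open>T = C - 1\<close> one has
  \<open>C' = C (x + T)\<close> and \<open>T' = (1 + T) (x + T)\<close>, so by induction
  \<open>(\<Theta> C)\<^sup>(\<^sup>u\<^sup>) = C (\<alpha> + (x + T) \<beta>)\<close> with \<open>\<alpha>\<close> and \<open>\<beta>\<close> built positively from \<open>\<Theta>\<close>, \<open>1 + x\<close> and \<open>T\<close>.
  Putting \<open>B = e\<^sup>t C\<close>, the two parts of the symmetric decomposition are \<open>B \<alpha> + B T \<beta>\<close> and \<open>B \<beta>\<close>.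
  This only uses that the polynomials in question form cones, graded by the center and closed
  under multiplication.
\<close>

section \<open>The Euler relation for relatively open convex sets\<close>

text \<open>Summing the jumps \<open>\<phi>(t) - \<phi>(t+)\<close> counts each point and each open interval with the sign \<open>e\<close>.\<close>

lemma interval_euler_relation:
  fixes a e l :: "'i \<Rightarrow> real" and J :: "'i \<Rightarrow> real set"
  assumes fin: "finite I"
    and J: "\<And>i. i \<in> I \<Longrightarrow> J i = {l i} \<and> e i = 1 \<or> (\<exists>u>l i. J i = {l i<..<u} \<and> e i = -1)"
    and zero: "\<And>t. (\<Sum>i\<in>I. a i * e i * indicator (J i) t) = 0"
  shows "(\<Sum>i\<in>I. a i) = 0"
proof -
  obtain u where u: "\<And>i. i \<in> I \<Longrightarrow> J i = {l i} \<and> e i = 1 \<or> (l i < u i \<and> J i = {l i<..<u i} \<and> e i = -1)"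
    using J by metis
  let ?T = "l ` I" and ?Y = "l ` I \<union> u ` I"
  \<comment> \<open>A step below all positive gaps from a left end to another endpoint: nothing
    changes between just after \<open>t\<close> and \<open>t + \<epsilon>\<close>.\<close>
  have "\<exists>\<epsilon>>0. \<forall>t\<in>?T. \<forall>y\<in>?Y. t < y \<longrightarrow> t + \<epsilon> < y"
  proof -
    let ?D = "(\<lambda>(t, y). y - t) ` ((?T \<times> ?Y) \<inter> {(t, y). t < y})"
    have "finite ?D" using fin by auto
    have "\<exists>\<epsilon>>0. \<forall>d\<in>?D. \<epsilon> < d"
    proof (cases "?D = {}")
      case True then show ?thesis by (intro exI[of _ 1]) auto
    next
      case False
      have "Min ?D \<in> ?D" using False \<open>finite ?D\<close> by (rule Min_in[rotated])
      then have "0 < Min ?D" by auto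
      moreover have "Min ?D / 2 < d" if "d \<in> ?D" for d
        using Min_le[OF \<open>finite ?D\<close> that] \<open>0 < Min ?D\<close> by linarith
      ultimately show ?thesis by (intro exI[of _ "Min ?D / 2"]) auto
    qed
    then show ?thesis by force
  qed
  then obtain \<epsilon> where \<epsilon>: "\<epsilon> > 0" "\<And>t y. t \<in> ?T \<Longrightarrow> y \<in> ?Y \<Longrightarrow> t < y \<Longrightarrow> t + \<epsilon> < y"
    by blast
  \<comment> \<open>At its own left end a point has jump 1 and an open interval has jump -1, which
    the sign \<open>e i\<close> turns into 1. At every other left end the jump is 0, even when it
    equals \<open>u i\<close>, since the interval is open on the right.\<close>
  have *: "e i * (indicator (J i) t - indicator (J i) (t + \<epsilon>)) = (if t = l i then 1 else 0)"
    if "i \<in> I" "t \<in> ?T" for i t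
  proof (cases "J i = {l i} \<and> e i = 1")
    case True
    then show ?thesis
      using \<epsilon>(1) \<epsilon>(2)[OF that(2), of "l i"] that(1) by (cases t "l i" rule: linorder_cases) (auto simp: indicator_def)
  next
    case False
    then have "l i < u i" "J i = {l i<..<u i}" "e i = -1"
      using u[OF that(1)] by auto
    then show ?thesis
      using \<epsilon>(1) \<epsilon>(2)[OF that(2), of "l i"] \<epsilon>(2)[OF that(2), of "u i"] that(1)
      by (cases t "l i" rule: linorder_cases; cases t "u i" rule: linorder_cases) (auto simp: indicator_def)
  qed
  have "0 = (\<Sum>t\<in>?T. (\<Sum>i\<in>I. a i * e i * indicator (J i) t) - (\<Sum>i\<in>I. a i * e i * indicator (J i) (t + \<epsilon>)))"
    by (simp only: zero) simp
  also have "\<dots> = (\<Sum>t\<in>?T. \<Sum>i\<in>I. a i * (e i * (indicator (J i) t - indicator (J i) (t + \<epsilon>))))"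
    by (simp add: sum_subtractf[symmetric] algebra_simps)
  also have "\<dots> = (\<Sum>i\<in>I. \<Sum>t\<in>?T. a i * (if t = l i then 1 else 0))"
    by (subst sum.swap) (auto intro!: sum.cong simp: *)
  also have "\<dots> = (\<Sum>i\<in>I. a i)"
    using fin by (intro sum.cong) (auto simp: sum_distrib_left[symmetric])
  finally show ?thesis ..
qed

text \<open>Linear maps preserve convexity and relative openness. On the real line a nonempty set
  with both properties has dimension 0 and is a point, or has dimension 1 and is an open interval,
  here with finite ends by boundedness.\<close>

lemma rel_open_convex_inner_image:
  fixes C :: "'e::euclidean_space set"
  assumes "convex C" "rel_open C" "bounded C" "C \<noteq> {}"
  shows "(\<exists>l. (\<bullet>) c ` C = {l}) \<or> (\<exists>l u. l < u \<and> (\<bullet>) c ` C = {l<..<u})"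
proof -
  let ?J = "(\<bullet>) c ` C"
  have lin: "linear ((\<bullet>) c)"
    by (simp add: bounded_linear.linear bounded_linear_inner_right)
  have J: "convex ?J" "rel_open ?J" "bounded ?J" "?J \<noteq> {}"
    using convex_rel_open_linear_image[OF lin assms(1,2)] assms(3,4)
      bounded_linear_image[OF assms(3) bounded_linear_inner_right] by auto
  show ?thesis
  proof (cases "aff_dim ?J = 0")
    case True
    then show ?thesis using aff_dim_eq_0[of ?J] by blast
  next
    case False
    have "aff_dim ?J \<ge> 0" "aff_dim ?J \<le> 1"
      using J(4) aff_dim_le_DIM[of ?J] aff_dim_geq[of ?J] by (auto simp: aff_dim_empty order.order_iff_strict)
    then have "aff_dim ?J = 1" using False by linarith
    then have "interior ?J = rel_interior ?J"
      by (intro interior_rel_interior_gen[THEN trans]) simp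
    then have op: "open ?J"
      using J(2) unfolding rel_open_def by (metis open_interior)
    have bdd: "bdd_below ?J" "bdd_above ?J"
      using J(3) by (auto intro: bounded_imp_bdd_below bounded_imp_bdd_above)
    have ivl: "is_interval ?J"
      using J(1) by (simp add: is_interval_convex_1)
    have bounds: "Inf ?J < t \<and> t < Sup ?J" if "t \<in> ?J" for t
    proof -
      obtain \<epsilon> where \<epsilon>: "\<epsilon> > 0" "ball t \<epsilon> \<subseteq> ?J"
        using op \<open>t \<in> ?J\<close> openE by blast
      then have "t - \<epsilon> / 2 \<in> ?J" "t + \<epsilon> / 2 \<in> ?J"
        by (auto intro!: subsetD[OF \<epsilon>(2)] simp: dist_real_def)
      then show ?thesis
        using cInf_lower[OF _ bdd(1)] cSup_upper[OF _ bdd(2)] \<epsilon>(1) by fastforce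
    qed
    have "?J = {Inf ?J<..<Sup ?J}"
    proof
      show "?J \<subseteq> {Inf ?J<..<Sup ?J}" using bounds by auto
      show "{Inf ?J<..<Sup ?J} \<subseteq> ?J"
      proof
        fix t assume t: "t \<in> {Inf ?J<..<Sup ?J}"
        then obtain y z where "y \<in> ?J" "y < t" "z \<in> ?J" "t < z"
          using cInf_lessD[OF J(4)] less_cSupD[OF J(4)] by (metis greaterThanLessThan_iff)
        then show "t \<in> ?J"
          using ivl unfolding is_interval_1 by (meson less_imp_le)
      qed
    qed
    moreover have "Inf ?J < Sup ?J" using J(4) bounds by (metis all_not_in_conv less_trans)
    ultimately show ?thesis by blast
  qed
qed

text \<open>The slice is nonempty and open in \<open>affine hull C\<close> cut by the hyperplane, so
  it spans this affine space, which has one dimension less because the hyperplane does not contain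
  \<open>C\<close>.\<close>

lemma rel_open_Int_hyperplane:
  fixes C :: "'e::euclidean_space set"
  assumes "rel_open C" "C \<inter> {x. c \<bullet> x = t} \<noteq> {}" "\<not> C \<subseteq> {x. c \<bullet> x = t}"
  shows "rel_open (C \<inter> {x. c \<bullet> x = t})" "aff_dim (C \<inter> {x. c \<bullet> x = t}) = aff_dim C - 1"
proof -
  let ?H = "{x. c \<bullet> x = t}"
  let ?A = "affine hull C \<inter> ?H"
  have aff: "affine ?A" by (simp add: affine_Int affine_hyperplane)
  have "openin (top_of_set (affine hull C)) C"
    using assms(1) by (simp add: rel_open)
  then have op: "openin (top_of_set ?A) (C \<inter> ?H)"
    by (metis inf.absorb_iff2 hull_subset inf_commute openin_subtopology_Int subtopology_subtopology)
  have hull: "affine hull (C \<inter> ?H) = ?A"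
  proof -
    have "affine hull (C \<inter> ?H) = affine hull ?A"
      using op assms(2) aff by (intro affine_hull_openin) (simp_all add: hull_same)
    then show ?thesis using aff by (simp add: hull_same)
  qed
  show "rel_open (C \<inter> ?H)"
    using op by (simp add: rel_open hull)
  have "aff_dim (C \<inter> ?H) = aff_dim ?A"
    by (metis aff_dim_affine_hull hull)
  also have "\<dots> = aff_dim C - 1"
    using assms(2,3) hull_subset[of C affine]
    by (subst aff_dim_affine_Int_hyperplane) (auto simp: affine_affine_hull)
  finally show "aff_dim (C \<inter> ?H) = aff_dim C - 1" .
qed

text \<open>Induction on the dimension by slicing with the level sets of a linear functional. The
  relations on the slices combine into a relation between the images on the real line, where
  \<open>interval_euler_relation\<close> applies.\<close>

lemma euler_relation_in_affine:
  fixes C :: "'i \<Rightarrow> 'e::euclidean_space set" and a :: "'i \<Rightarrow> real"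
  assumes "finite I"
    and "\<And>i. i \<in> I \<Longrightarrow> convex (C i) \<and> rel_open (C i) \<and> bounded (C i) \<and> C i \<noteq> {} \<and> C i \<subseteq> L"
    and "affine L" "aff_dim L \<le> int d"
    and "\<And>x. (\<Sum>i\<in>I. a i * indicator (C i) x) = 0"
  shows "(\<Sum>i\<in>I. a i * (-1) ^ nat (aff_dim (C i))) = 0"
  using assms
proof (induction d arbitrary: I C L)
  case 0
  show ?case
  proof (cases "I = {}")
    case False
    then obtain i where "i \<in> I" by blast
    then have "L \<noteq> {}" using "0.prems"(2) by blast
    then have "aff_dim L = 0"
      using "0.prems"(4) aff_dim_negative_iff[of L] by linarith
    then obtain p where "L = {p}" using aff_dim_eq_0 by blast
    then have C: "C i = {p}" if "i \<in> I" for i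
      using "0.prems"(2)[OF that] by blast
    then show ?thesis using "0.prems"(5)[of p] by simp
  qed simp
next
  case (Suc d)
  show ?case
  proof (cases "aff_dim L \<le> int d")
    case True
    then show ?thesis using Suc.IH[OF Suc.prems(1,2,3) _ Suc.prems(5)] by blast
  next
    case False
    then have dL: "aff_dim L = int d + 1" using Suc.prems(4) by simp
    have "\<exists>p\<in>L. \<exists>q\<in>L. p \<noteq> q"
    proof (rule ccontr)
      assume "\<not> ?thesis"
      then have "L = {} \<or> (\<exists>p. L = {p})" by blast
      then show False using dL by auto
    qed
    then obtain p q where pq: "p \<in> L" "q \<in> L" "p \<noteq> q" by blast
    \<comment> \<open>The functional separates \<open>p\<close> from \<open>q\<close>, so no level
      set contains \<open>L\<close> and each slice of \<open>L\<close> has smaller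
      dimension.\<close>
    define c where "c = q - p"
    have "c \<bullet> q - c \<bullet> p = c \<bullet> c" by (simp add: c_def inner_diff_right)
    also have "c \<bullet> c > 0" using pq(3) by (simp add: c_def)
    finally have npq: "c \<bullet> q \<noteq> c \<bullet> p" by simp
    let ?H = "\<lambda>t. {x. c \<bullet> x = t}"
    define J where "J i = (\<bullet>) c ` C i" for i
    \<comment> \<open>The effect of slicing on the sign: a set on which the functional is constant
      is its own only slice, and any other set loses exactly one dimension.\<close>
    define e :: "'i \<Rightarrow> real" where "e i = (if \<exists>l. J i = {l} then 1 else -1)" for i
    have "\<exists>l. J i = {l} \<and> e i = 1 \<or> (\<exists>u>l. J i = {l<..<u} \<and> e i = -1)" if "i \<in> I" for i
    proof (cases "\<exists>l. J i = {l}")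
      case False
      then show ?thesis
        using rel_open_convex_inner_image[of "C i" c] Suc.prems(2)[OF that] unfolding e_def J_def by auto
    qed (auto simp: e_def)
    then obtain l where l: "\<And>i. i \<in> I \<Longrightarrow> J i = {l i} \<and> e i = 1 \<or> (\<exists>u>l i. J i = {l i<..<u} \<and> e i = -1)"
      by metis
    have slice: "(-1) ^ nat (aff_dim (C i \<inter> ?H t)) = e i * (-1) ^ nat (aff_dim (C i)) \<and>
        rel_open (C i \<inter> ?H t)" if "i \<in> I" "t \<in> J i" for i t
    proof (cases "J i = {l i}")
      case True
      then have "c \<bullet> x = t" if "x \<in> C i" for x
        using that \<open>t \<in> J i\<close> unfolding J_def by (metis imageI singletonD)
      then have "C i \<inter> ?H t = C i" by blast
      moreover have "e i = 1" unfolding e_def using True by auto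
      ultimately show ?thesis using Suc.prems(2)[OF that(1)] by simp
    next
      case False
      then obtain u where u: "u > l i" "J i = {l i<..<u}" "e i = -1"
        using l[OF \<open>i \<in> I\<close>] by auto
      have ne: "C i \<inter> ?H t \<noteq> {}" using that(2) unfolding J_def by blast
      have "\<not> C i \<subseteq> ?H t"
      proof
        assume "C i \<subseteq> ?H t"
        then have sub: "J i \<subseteq> {t}" unfolding J_def by auto
        obtain t' where "max t (l i) < t'" "t' < u"
          using dense[of "max t (l i)" u] u \<open>t \<in> J i\<close> by auto
        then have "t' \<in> J i" "t' \<noteq> t" unfolding u(2) by auto
        then show False using sub by blast
      qed
      from rel_open_Int_hyperplane[OF _ ne this]
      have s: "rel_open (C i \<inter> ?H t)" "aff_dim (C i \<inter> ?H t) = aff_dim (C i) - 1"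
        using Suc.prems(2)[OF that(1)] by auto
      have "aff_dim (C i \<inter> ?H t) \<ge> 0"
        using ne by (metis aff_dim_negative_iff linorder_not_less)
      then have "nat (aff_dim (C i)) = Suc (nat (aff_dim (C i \<inter> ?H t)))"
        using s(2) by simp
      then show ?thesis using s(1) u(3) by simp
    qed
    \<comment> \<open>This is the induction hypothesis for the slices at level \<open>t\<close>,
      restricted to the indices whose slice is nonempty.\<close>
    have "(\<Sum>i\<in>I. (a i * (-1) ^ nat (aff_dim (C i))) * e i * indicator (J i) t) = 0" for t
    proof -
      let ?I = "{i\<in>I. t \<in> J i}"
      have "(\<Sum>i\<in>?I. a i * (-1) ^ nat (aff_dim (C i \<inter> ?H t))) = 0"
      proof (rule Suc.IH[of _ _ "L \<inter> ?H t"])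
        show "finite ?I" using Suc.prems(1) by simp
        show "affine (L \<inter> ?H t)" using Suc.prems(3) by (simp add: affine_Int affine_hyperplane)
        have "\<not> L \<subseteq> ?H t" using pq npq by auto
        then show "aff_dim (L \<inter> ?H t) \<le> int d"
          using dL Suc.prems(3) by (simp add: aff_dim_affine_Int_hyperplane)
        show "convex (C i \<inter> ?H t) \<and> rel_open (C i \<inter> ?H t) \<and> bounded (C i \<inter> ?H t) \<and>
            C i \<inter> ?H t \<noteq> {} \<and> C i \<inter> ?H t \<subseteq> L \<inter> ?H t" if "i \<in> ?I" for i
          using that slice[of i t] Suc.prems(2)[of i]
          by (auto simp: J_def convex_Int convex_hyperplane bounded_Int)
        show "(\<Sum>i\<in>?I. a i * indicator (C i \<inter> ?H t) x) = 0" for x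
        proof (cases "c \<bullet> x = t")
          case True
          have "(\<Sum>i\<in>?I. a i * indicator (C i \<inter> ?H t) x) = (\<Sum>i\<in>I. a i * indicator (C i) x)"
            using Suc.prems(1) True
            by (intro sum.mono_neutral_cong_left) (auto simp: J_def indicator_def)
          then show ?thesis using Suc.prems(5) by simp
        qed (simp add: indicator_def)
      qed
      also have "(\<Sum>i\<in>?I. a i * (-1) ^ nat (aff_dim (C i \<inter> ?H t)))
          = (\<Sum>i\<in>I. (a i * (-1) ^ nat (aff_dim (C i))) * e i * indicator (J i) t)"
        using Suc.prems(1) slice
        by (intro sum.mono_neutral_cong_left) (auto simp: indicator_def)
      finally show ?thesis .
    qed
    from interval_euler_relation[OF Suc.prems(1) l this] show ?thesis .
  qed
qed

text \<open>The function \<open>(-1) ^ dim\<close> on bounded nonempty relatively open convex sets is the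
  compactly supported Euler characteristic, hence additive over finite partitions.\<close>

theorem euler_relation_rel_open_convex:
  fixes C :: "'i \<Rightarrow> 'e::euclidean_space set"
  assumes fin: "finite I"
    and C: "\<And>i. i \<in> I \<Longrightarrow> convex (C i) \<and> rel_open (C i) \<and> C i \<noteq> {}"
    and disj: "disjoint_family_on C I"
    and U: "U = (\<Union>i\<in>I. C i)" "convex U" "rel_open U" "bounded U" "U \<noteq> {}"
  shows "(\<Sum>i\<in>I. (-1) ^ nat (aff_dim (C i))) = ((-1) ^ nat (aff_dim U) :: real)"
proof -
  \<comment> \<open>The index \<open>None\<close> carries \<open>U\<close> with weight -1, so that
    the partition becomes a vanishing combination of indicators.\<close>
  define D where "D j = (case j of None \<Rightarrow> U | Some i \<Rightarrow> C i)" for j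
  define a :: "'i option \<Rightarrow> real" where "a j = (case j of None \<Rightarrow> -1 | Some i \<Rightarrow> 1)" for j
  let ?J = "insert None (Some ` I)"
  have sum_J: "(\<Sum>j\<in>?J. f j) = f None + (\<Sum>i\<in>I. f (Some i))" for f :: "'i option \<Rightarrow> real"
    using fin by (subst sum.insert) (auto simp: sum.reindex)
  have "(\<Sum>j\<in>?J. a j * (-1) ^ nat (aff_dim (D j))) = 0"
  proof (rule euler_relation_in_affine[where L = UNIV and d = "DIM('e)"])
    show "convex (D j) \<and> rel_open (D j) \<and> bounded (D j) \<and> D j \<noteq> {} \<and> D j \<subseteq> UNIV" if "j \<in> ?J" for j
    proof -
      have "D j \<subseteq> U"
        using that U(1) by (auto simp: D_def)
      then have "bounded (D j)"
        using bounded_subset[OF U(4)] by blast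
      then show ?thesis
        using that C U(2-5) by (auto simp: D_def)
    qed
    show "(\<Sum>j\<in>?J. a j * indicator (D j) x) = 0" for x
    proof (cases "x \<in> U")
      case True
      then obtain k where k: "k \<in> I" "x \<in> C k" using U by blast
      have "(\<Sum>i\<in>I. indicator (C i) x :: real) = (\<Sum>i\<in>I. if i = k then 1 else 0)"
        using disj k unfolding disjoint_family_on_def by (intro sum.cong) (auto simp: indicator_def)
      then show ?thesis using True k(1) fin by (simp add: sum_J a_def D_def)
    next
      case False
      then have "indicator (C i) x = (0::real)" if "i \<in> I" for i using that U by auto
      then show ?thesis using False by (simp add: sum_J a_def D_def)
    qed
  qed (use fin in auto)
  then show ?thesis by (simp add: sum_J a_def D_def)
qed

section \<open>Local Euler relation in a triangulated simplex\<close>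

lemma rel_open_Int_open:
  fixes A :: "'e::euclidean_space set"
  assumes "rel_open A" "open N" "A \<inter> N \<noteq> {}"
  shows "rel_open (A \<inter> N)" "aff_dim (A \<inter> N) = aff_dim A"
proof -
  have op: "openin (top_of_set (affine hull A)) (A \<inter> N)"
    using assms(1,2) by (simp add: rel_open openin_Int_open)
  then have hull: "affine hull (A \<inter> N) = affine hull A"
    using affine_hull_openin[of "affine hull A" "A \<inter> N"] assms(3) by (simp add: hull_hull)
  show "rel_open (A \<inter> N)"
    using op by (simp add: rel_open hull)
  show "aff_dim (A \<inter> N) = aff_dim A"
    by (metis hull aff_dim_affine_hull)
qed

text \<open>The subspaces are removed one at a time. Each is closed, so the rest stays open in
  \<open>A\<close>. It is also nonempty, because a nonempty open subset of \<open>A\<close> spans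
  \<open>A\<close> and cannot lie in a subspace of smaller dimension.\<close>

lemma openin_affine_not_covered:
  fixes A :: "'e::euclidean_space set"
  assumes "finite \<F>" "affine A" "openin (top_of_set A) U" "U \<noteq> {}"
    and "\<And>L. L \<in> \<F> \<Longrightarrow> affine L \<and> aff_dim L < aff_dim A"
  shows "\<not> U \<subseteq> \<Union>\<F>"
  using assms
proof (induction \<F> arbitrary: U rule: finite_induct)
  case (insert L \<F>)
  have "openin (top_of_set A) (U - L)"
  proof -
    have "closed L" using insert.prems(4)[of L] by (simp add: affine_closed)
    then show ?thesis
      using insert.prems(2) by (simp add: Diff_eq openin_Int_open open_Compl)
  qed
  moreover have "U - L \<noteq> {}"
  proof
    assume "U - L = {}"
    then have "affine hull U \<subseteq> L"
      using insert.prems(4)[of L] by (intro hull_minimal) auto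
    moreover have "affine hull U = A"
      using affine_hull_openin[of A U] insert.prems(1-3) by (simp add: hull_same)
    ultimately show False
      using insert.prems(4)[of L] aff_dim_subset[of A L] by simp
  qed
  ultimately have "\<not> U - L \<subseteq> \<Union>\<F>"
    using insert.prems(1,4) by (intro insert.IH) auto
  then show ?case by blast
qed simp

lemma convex_hull_subset_simplex_face:
  fixes S :: "'e::euclidean_space set"
  assumes "\<not> affine_dependent S" "C \<subseteq> S"
  shows "convex hull C face_of convex hull S"
  using assms by (auto simp: face_of_convex_hull_affine_independent)

lemma point_in_simplex_cases:
  fixes S :: "'e::euclidean_space set"
  assumes "\<not> affine_dependent S" "x \<in> convex hull S" "x \<notin> rel_interior (convex hull S)"
  obtains a where "a \<in> S" "x \<in> convex hull (S - {a})"
proof -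
  have "x \<in> rel_frontier (convex hull S)"
    using assms(2,3) closure_subset unfolding rel_frontier_def by blast
  also have "\<dots> = \<Union>{convex hull (S - {a}) |a. a \<in> S}"
    using rel_frontier_convex_hull_cases[OF assms(1)] by simp
  finally show ?thesis using that by blast
qed

text \<open>The faces whose carrier, the smallest face of the simplex containing them, is
  \<open>F\<close>. The empty face is interior only for \<open>F = {}\<close>.\<close>

definition interior_faces ::
  "('a \<Rightarrow> 'e::euclidean_space) \<Rightarrow> 'b set set \<Rightarrow> ('b \<Rightarrow> 'e) \<Rightarrow> 'a set \<Rightarrow> 'b set set" where
  "interior_faces s \<Gamma> r F = restriction s \<Gamma> r F - boundary_restriction s \<Gamma> r F"

locale simplex_triangulation =
  fixes V :: "'a set" and s :: "'a \<Rightarrow> 'e::euclidean_space"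
    and \<Gamma> :: "'b set set" and r :: "'b \<Rightarrow> 'e"
  assumes finite_V: "finite V" and triangulation: "triangulation_of_simplex V s \<Gamma> r"
begin

abbreviation "\<sigma> F \<equiv> convex hull (s ` F)"
abbreviation "\<tau> G \<equiv> convex hull (r ` G)"
abbreviation "res \<equiv> restriction s \<Gamma> r"
abbreviation "bd \<equiv> boundary_restriction s \<Gamma> r"
abbreviation "int_faces \<equiv> interior_faces s \<Gamma> r"

section \<open>Faces of the two realizations\<close>

lemma realization_\<Gamma>: "geometric_realization \<Gamma> r"
  and realization_V: "geometric_realization (Pow V) s"
  and subdivides: "geometrically_subdivides \<Gamma> r (Pow V) s"
  using triangulation by (simp_all add: triangulation_of_simplex_def)

lemma complex_\<Gamma>: "abstract_complex \<Gamma>"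
  using realization_\<Gamma> by (simp add: geometric_realization_def)

lemma finite_\<Gamma>: "finite \<Gamma>"
  and empty_in_\<Gamma>: "{} \<in> \<Gamma>"
  and \<Gamma>_down: "G \<in> \<Gamma> \<Longrightarrow> H \<subseteq> G \<Longrightarrow> H \<in> \<Gamma>"
  and finite_face: "G \<in> \<Gamma> \<Longrightarrow> finite G"
  using complex_\<Gamma> unfolding abstract_complex_def by blast+

lemma inj_\<Gamma>: "G \<in> \<Gamma> \<Longrightarrow> inj_on r G"
  and indep_\<Gamma>: "G \<in> \<Gamma> \<Longrightarrow> \<not> affine_dependent (r ` G)"
  and Int_\<Gamma>: "G \<in> \<Gamma> \<Longrightarrow> H \<in> \<Gamma> \<Longrightarrow> \<tau> G \<inter> \<tau> H = \<tau> (G \<inter> H)"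
  using realization_\<Gamma> unfolding geometric_realization_def by simp_all

lemma inj_V: "F \<subseteq> V \<Longrightarrow> inj_on s F"
  and indep_V: "F \<subseteq> V \<Longrightarrow> \<not> affine_dependent (s ` F)"
  and Int_V: "E \<subseteq> V \<Longrightarrow> F \<subseteq> V \<Longrightarrow> \<sigma> E \<inter> \<sigma> F = \<sigma> (E \<inter> F)"
  using realization_V unfolding geometric_realization_def by simp_all

lemma \<Gamma>_sub: "G \<in> \<Gamma> \<Longrightarrow> \<exists>F\<subseteq>V. \<tau> G \<subseteq> \<sigma> F"
  and \<Gamma>_cover: "(\<Union>G\<in>\<Gamma>. \<tau> G) = (\<Union>F\<in>Pow V. \<sigma> F)"
  using subdivides unfolding geometrically_subdivides_def by (simp_all add: Bex_def)

lemma aff_dim_\<tau>: "G \<in> \<Gamma> \<Longrightarrow> aff_dim (\<tau> G) = int (card G) - 1"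
  using aff_dim_affine_independent[OF indep_\<Gamma>] by (simp add: aff_dim_convex_hull card_image inj_\<Gamma>)

lemma aff_dim_\<sigma>: "F \<subseteq> V \<Longrightarrow> aff_dim (\<sigma> F) = int (card F) - 1"
  using aff_dim_affine_independent[OF indep_V] by (simp add: aff_dim_convex_hull card_image inj_V)

lemma finite_sub: "F \<subseteq> V \<Longrightarrow> finite F"
  using finite_V finite_subset by blast

lemma \<sigma>_face_of: "E \<subseteq> F \<Longrightarrow> F \<subseteq> V \<Longrightarrow> \<sigma> E face_of \<sigma> F"
  by (intro convex_hull_subset_simplex_face indep_V) auto

lemma \<tau>_face_of: "H \<subseteq> G \<Longrightarrow> G \<in> \<Gamma> \<Longrightarrow> \<tau> H face_of \<tau> G"
  by (intro convex_hull_subset_simplex_face indep_\<Gamma>) auto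

text \<open>The point lies in \<open>\<tau> (G \<inter> H)\<close>, a face of
  \<open>\<tau> G\<close> meeting its relative interior and hence all of it. Comparing dimensions
  gives \<open>G \<inter> H = G\<close>.\<close>

lemma face_subset_of_rel_interior:
  assumes "G \<in> \<Gamma>" "H \<in> \<Gamma>" "x \<in> rel_interior (\<tau> G)" "x \<in> \<tau> H"
  shows "G \<subseteq> H"
proof -
  have "x \<in> \<tau> (G \<inter> H)"
    using assms Int_\<Gamma> rel_interior_subset by blast
  then have "\<tau> G \<subseteq> \<tau> (G \<inter> H)"
    using assms(3) by (intro subset_of_face_of[OF \<tau>_face_of[OF Int_lower1 assms(1)]]) blast+
  then have "aff_dim (\<tau> G) \<le> aff_dim (\<tau> (G \<inter> H))"
    by (rule aff_dim_subset)
  moreover have "G \<inter> H \<in> \<Gamma>" using \<Gamma>_down[OF assms(1)] by blast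
  ultimately have "card G \<le> card (G \<inter> H)"
    using assms(1) by (simp add: aff_dim_\<tau>)
  then have "G \<inter> H = G"
    using finite_face[OF assms(1)] by (intro card_seteq) auto
  then show ?thesis by blast
qed

section \<open>Restrictions to faces of the simplex and interior faces\<close>

lemma finite_res: "finite (res F)"
  using finite_\<Gamma> by (simp add: restriction_def)

lemma res_down: "G \<in> res F \<Longrightarrow> H \<subseteq> G \<Longrightarrow> H \<in> res F"
  unfolding restriction_def using \<Gamma>_down hull_mono[of "r ` H" "r ` G" convex]
  by (auto simp: image_mono)

lemma res_mono: "E \<subseteq> F \<Longrightarrow> res E \<subseteq> res F"
  unfolding restriction_def using hull_mono[of "s ` E" "s ` F" convex] by (auto simp: image_mono)

lemma res_Int: "E \<subseteq> V \<Longrightarrow> F \<subseteq> V \<Longrightarrow> G \<in> res E \<Longrightarrow> G \<in> res F \<Longrightarrow> G \<in> res (E \<inter> F)"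
  unfolding restriction_def by (simp flip: Int_V)

lemma empty_in_res: "{} \<in> res F"
  using empty_in_\<Gamma> by (simp add: restriction_def)

lemma res_subset_\<Gamma>: "G \<in> res F \<Longrightarrow> G \<in> \<Gamma>"
  by (simp add: restriction_def)

lemma res_empty: "res {} = {{}}"
  using empty_in_\<Gamma> by (auto simp: restriction_def)

lemma card_res_le: "F \<subseteq> V \<Longrightarrow> G \<in> res F \<Longrightarrow> card G \<le> card F"
  by (rule card_face_restriction_le[OF triangulation])

lemma int_faces_iff: "G \<in> int_faces F \<longleftrightarrow> G \<in> res F \<and> (\<forall>E. E \<subset> F \<longrightarrow> G \<notin> res E)"
  by (auto simp: interior_faces_def boundary_restriction_def)

lemma finite_int_faces: "finite (int_faces F)"
  using finite_res by (simp add: interior_faces_def)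

text \<open>Take a face with fewest vertices among those containing \<open>x\<close>: if
  \<open>x\<close> were on its frontier, a vertex could be dropped.\<close>

lemma carrier_exists:
  assumes "F \<subseteq> V" "x \<in> \<sigma> F"
  obtains G where "G \<in> res F" "x \<in> rel_interior (\<tau> G)"
proof -
  have "x \<in> (\<Union>G\<in>\<Gamma>. \<tau> G)"
    unfolding \<Gamma>_cover using assms by (intro UN_I[of F]) auto
  then have "\<exists>G. G \<in> \<Gamma> \<and> x \<in> \<tau> G"
    by blast
  then obtain G where G: "G \<in> \<Gamma>" "x \<in> \<tau> G"
    and min: "\<And>H. H \<in> \<Gamma> \<Longrightarrow> x \<in> \<tau> H \<Longrightarrow> card G \<le> card H"
    using ex_has_least_nat[of "\<lambda>G. G \<in> \<Gamma> \<and> x \<in> \<tau> G" _ card] by blast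
  have x: "x \<in> rel_interior (\<tau> G)"
  proof (rule ccontr)
    assume "x \<notin> rel_interior (\<tau> G)"
    then obtain a where a: "a \<in> G" "x \<in> convex hull (r ` G - {r a})"
      using point_in_simplex_cases[OF indep_\<Gamma>[OF G(1)] G(2)] by blast
    then have "r ` G - {r a} = r ` (G - {a})"
      using inj_\<Gamma>[OF G(1)] unfolding inj_on_def by auto
    then have "card G \<le> card (G - {a})"
      using a min[of "G - {a}"] \<Gamma>_down[OF G(1)] by auto
    then show False
      using card_Diff1_less[OF finite_face[OF G(1)] a(1)] by simp
  qed
  \<comment> \<open>\<open>\<sigma> F\<close> is a face of the convex set \<open>\<sigma> V\<close>
    and meets the relative interior of \<open>\<tau> G \<subseteq> \<sigma> V\<close> at
    \<open>x\<close>, so it contains \<open>\<tau> G\<close>.\<close>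
  obtain F' where "F' \<subseteq> V" "\<tau> G \<subseteq> \<sigma> F'"
    using \<Gamma>_sub[OF G(1)] by blast
  then have "\<tau> G \<subseteq> \<sigma> V"
    using hull_mono[of "s ` F'" "s ` V" convex] by blast
  then have "\<tau> G \<subseteq> \<sigma> F"
    using assms(2) x by (intro subset_of_face_of[OF \<sigma>_face_of[OF assms(1) order_refl]]) blast+
  then show ?thesis
    using that G(1) x by (simp add: restriction_def)
qed

text \<open>A point of the frontier of \<open>\<sigma> F\<close> lies in some facet of
  \<open>\<sigma> F\<close>. That facet would contain the whole of \<open>\<tau> G\<close>, putting
  \<open>G\<close> in the boundary.\<close>

lemma rel_interior_int_faces:
  assumes "F \<subseteq> V" "G \<in> int_faces F"
  shows "rel_interior (\<tau> G) \<subseteq> rel_interior (\<sigma> F)"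
proof
  fix x assume x: "x \<in> rel_interior (\<tau> G)"
  have "G \<in> res F" and bd: "\<And>E. E \<subset> F \<Longrightarrow> G \<notin> res E"
    using assms(2) by (simp_all add: int_faces_iff)
  then have G: "\<tau> G \<subseteq> \<sigma> F" "G \<in> \<Gamma>"
    by (simp_all add: restriction_def)
  show "x \<in> rel_interior (\<sigma> F)"
  proof (rule ccontr)
    assume "x \<notin> rel_interior (\<sigma> F)"
    moreover have "x \<in> \<sigma> F" using x G rel_interior_subset by blast
    ultimately obtain a where a: "a \<in> F" "x \<in> convex hull (s ` F - {s a})"
      using point_in_simplex_cases[OF indep_V[OF assms(1)]] by blast
    then have "s ` F - {s a} = s ` (F - {a})"
      using inj_V[OF assms(1)] unfolding inj_on_def by auto
    then have "\<tau> G \<subseteq> \<sigma> (F - {a})"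
      using a x by (intro subset_of_face_of[OF \<sigma>_face_of[OF Diff_subset assms(1)] G(1)]) auto
    then show False
      using bd[of "F - {a}"] a(1) G(2) by (auto simp: restriction_def)
  qed
qed

lemma \<sigma>_inj: "F \<subseteq> V \<Longrightarrow> E \<subset> F \<Longrightarrow> \<sigma> E \<noteq> \<sigma> F"
proof
  assume *: "F \<subseteq> V" "E \<subset> F" "\<sigma> E = \<sigma> F"
  then have "aff_dim (\<sigma> E) = int (card E) - 1" "aff_dim (\<sigma> F) = int (card F) - 1"
    by (intro aff_dim_\<sigma>; blast)+
  then show False
    using psubset_card_mono[OF finite_sub[OF *(1)] *(2)] *(3) by simp
qed

text \<open>Proper faces of \<open>\<sigma> F\<close> miss its relative interior, so none of them
  can contain \<open>\<tau> G\<close>.\<close>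

lemma int_facesI:
  assumes "F \<subseteq> V" "G \<in> res F" "x \<in> rel_interior (\<tau> G)" "x \<in> rel_interior (\<sigma> F)"
  shows "G \<in> int_faces F"
  unfolding int_faces_iff
proof (intro conjI allI impI notI)
  fix E assume E: "E \<subset> F" "G \<in> res E"
  then have "x \<in> \<sigma> E"
    using assms(3) rel_interior_subset unfolding restriction_def by blast
  moreover have "\<sigma> E \<inter> rel_interior (\<sigma> F) = {}"
    using E(1) assms(1) by (intro face_of_disjoint_rel_interior \<sigma>_face_of \<sigma>_inj) auto
  ultimately show False using assms(4) by blast
qed (rule assms(2))

text \<open>\<open>N\<close> is a ball around a point in the relative interior of
  \<open>\<tau> H\<close>, small enough to miss the closed union of all faces not containing
  \<open>H\<close>. Its center is in the closure of the relative interior of each face containing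
  \<open>H\<close>. An empty \<open>H\<close> has no such point, but then the whole space
  serves.\<close>

lemma star_neighbourhood:
  assumes "F \<subseteq> V" "F \<noteq> {}" "H \<in> res F"
  obtains N where "open N" "convex N" "rel_interior (\<sigma> F) \<inter> N \<noteq> {}"
    "\<And>G. G \<in> int_faces F \<Longrightarrow> H \<subseteq> G \<Longrightarrow> rel_interior (\<tau> G) \<inter> N \<noteq> {}"
    "\<And>G. G \<in> \<Gamma> \<Longrightarrow> \<tau> G \<inter> N \<noteq> {} \<Longrightarrow> H \<subseteq> G"
proof (cases "H = {}")
  case True
  have "rel_interior (\<sigma> F) \<noteq> {}"
    using assms(2) by (simp add: rel_interior_eq_empty)
  moreover have "rel_interior (\<tau> G) \<noteq> {}" if "G \<in> int_faces F" for G
  proof -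
    have "G \<noteq> {}" using that assms(2) empty_in_res unfolding int_faces_iff by blast
    then show ?thesis by (simp add: rel_interior_eq_empty)
  qed
  ultimately show ?thesis
    using True by (intro that[of UNIV]) auto
next
  case False
  then have H: "H \<in> \<Gamma>" "\<tau> H \<subseteq> \<sigma> F" using assms(3) by (auto simp: restriction_def)
  have "rel_interior (\<tau> H) \<noteq> {}" using False by (simp add: rel_interior_eq_empty)
  then obtain p where p: "p \<in> rel_interior (\<tau> H)" by blast
  have pH: "p \<in> \<tau> H" using p rel_interior_subset by blast
  let ?K = "\<Union>G\<in>{G\<in>\<Gamma>. \<not> H \<subseteq> G}. \<tau> G"
  have "closed (\<tau> G)" if "G \<in> \<Gamma>" for G
    using finite_face[OF that] by (simp add: compact_imp_closed finite_imp_compact_convex_hull)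
  then have "closed ?K"
    using finite_\<Gamma> by (intro closed_UN) simp_all
  moreover have "p \<notin> ?K"
    using face_subset_of_rel_interior[OF H(1) _ p] by blast
  ultimately have "open (- ?K)" "p \<in> - ?K"
    by (simp_all only: open_Compl Compl_iff not_False_eq_True)
  then obtain \<epsilon> where \<epsilon>: "\<epsilon> > 0" "ball p \<epsilon> \<subseteq> - ?K"
    by (rule openE)
  have meets: "rel_interior S \<inter> ball p \<epsilon> \<noteq> {}" if "convex S" "p \<in> S" for S
  proof -
    have "p \<in> closure (rel_interior S)"
      using that closure_subset by (auto simp: convex_closure_rel_interior)
    then show ?thesis
      using \<epsilon>(1) by (metis centre_in_ball disjoint_iff open_Int_closure_eq_empty open_ball)
  qed
  show ?thesis
  proof (rule that[of "ball p \<epsilon>"])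
    show "rel_interior (\<sigma> F) \<inter> ball p \<epsilon> \<noteq> {}"
      using pH H(2) by (intro meets) auto
    show "rel_interior (\<tau> G) \<inter> ball p \<epsilon> \<noteq> {}" if "G \<in> int_faces F" "H \<subseteq> G" for G
    proof (rule meets)
      show "p \<in> \<tau> G" using pH hull_mono[of "r ` H" "r ` G" convex] that(2) by blast
    qed simp
    show "H \<subseteq> G" if "G \<in> \<Gamma>" "\<tau> G \<inter> ball p \<epsilon> \<noteq> {}" for G
      using that \<epsilon>(2) by blast
  qed auto
qed

text \<open>Inside a neighbourhood \<open>N\<close> as above, the relative interior of
  \<open>\<sigma> F\<close> is partitioned by the relative interiors of the interior faces
  containing \<open>H\<close>, and intersecting with \<open>N\<close> changes no dimension. The
  claim is the additivity of the Euler characteristic.\<close>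

theorem local_euler_relation:
  assumes "F \<subseteq> V" "H \<in> res F"
  shows "(\<Sum>G\<in>{G\<in>int_faces F. H \<subseteq> G}. (-1) ^ card G) = ((-1) ^ card F :: real)"
proof (cases "F = {}")
  case True
  then have "{G\<in>int_faces F. H \<subseteq> G} = {{}}"
    using assms(2) res_empty by (auto simp: int_faces_iff)
  then show ?thesis using True by simp
next
  case False
  obtain N where N: "open N" "convex N" "rel_interior (\<sigma> F) \<inter> N \<noteq> {}"
    "\<And>G. G \<in> int_faces F \<Longrightarrow> H \<subseteq> G \<Longrightarrow> rel_interior (\<tau> G) \<inter> N \<noteq> {}"
    "\<And>G. G \<in> \<Gamma> \<Longrightarrow> \<tau> G \<inter> N \<noteq> {} \<Longrightarrow> H \<subseteq> G"
    using star_neighbourhood[OF assms(1) False assms(2)] by blast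
  let ?I = "{G\<in>int_faces F. H \<subseteq> G}"
  let ?C = "\<lambda>G. rel_interior (\<tau> G) \<inter> N" and ?U = "rel_interior (\<sigma> F) \<inter> N"
  have I: "G \<in> \<Gamma>" "G \<in> res F" "G \<noteq> {}" if "G \<in> ?I" for G
    using that False empty_in_res[of "{}"] unfolding int_faces_iff restriction_def by auto
  have ro: "rel_open (rel_interior S)" if "convex S" for S :: "'e set"
    using that by (simp add: rel_open_def rel_interior_rel_interior)
  have "(\<Sum>G\<in>?I. (-1) ^ nat (aff_dim (?C G))) = ((-1) ^ nat (aff_dim ?U) :: real)"
  proof (rule euler_relation_rel_open_convex)
    show "finite ?I" using finite_int_faces by simp
    show "convex (?C G) \<and> rel_open (?C G) \<and> ?C G \<noteq> {}" if "G \<in> ?I" for G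
      using that N rel_open_Int_open[OF ro, of "\<tau> G" N] by (auto simp: convex_Int convex_rel_interior)
    show "disjoint_family_on ?C ?I"
      unfolding disjoint_family_on_def
    proof (intro ballI impI)
      fix G G' assume G: "G \<in> ?I" "G' \<in> ?I" "G \<noteq> G'"
      have "G = G'" if "x \<in> rel_interior (\<tau> G)" "x \<in> rel_interior (\<tau> G')" for x
        using face_subset_of_rel_interior[of G G' x] face_subset_of_rel_interior[of G' G x]
          I(1)[OF G(1)] I(1)[OF G(2)] that rel_interior_subset by blast
      then show "?C G \<inter> ?C G' = {}" using G(3) by blast
    qed
    show "?U = (\<Union>G\<in>?I. ?C G)"
    proof
      show "(\<Union>G\<in>?I. ?C G) \<subseteq> ?U"
        using rel_interior_int_faces[OF assms(1)] by blast
      show "?U \<subseteq> (\<Union>G\<in>?I. ?C G)"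
      proof
        fix x assume x: "x \<in> ?U"
        then have "x \<in> \<sigma> F" using rel_interior_subset by blast
        then obtain G where G: "G \<in> res F" "x \<in> rel_interior (\<tau> G)"
          using carrier_exists[OF assms(1)] by blast
        then have "G \<in> int_faces F" using x int_facesI[OF assms(1)] by blast
        moreover have "H \<subseteq> G"
          using N(5)[OF res_subset_\<Gamma>[OF G(1)]] G(2) x rel_interior_subset by blast
        ultimately show "x \<in> (\<Union>G\<in>?I. ?C G)" using G(2) x by blast
      qed
    qed
    show "convex ?U" using N(2) by (simp add: convex_Int convex_rel_interior)
    show "rel_open ?U" using rel_open_Int_open[OF ro N(1,3)] by simp
    have "bounded (\<sigma> F)"
      using finite_sub[OF assms(1)] by (simp add: bounded_convex_hull finite_imp_bounded)
    then show "bounded ?U"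
      using bounded_subset[of "\<sigma> F" ?U] rel_interior_subset by blast
  qed (rule N(3))
  moreover have "aff_dim ?U = int (card F) - 1"
    using rel_open_Int_open(2)[OF ro N(1,3)] by (simp add: rel_interior_aff_dim aff_dim_\<sigma>[OF assms(1)])
  moreover have "aff_dim (?C G) = int (card G) - 1" if "G \<in> ?I" for G
    using that rel_open_Int_open(2)[OF ro N(1), of "\<tau> G"] N(4) I(1)[OF that]
    by (simp add: rel_interior_aff_dim aff_dim_\<tau>)
  moreover have "nat (int k - 1) = k - 1" for k
    by simp
  ultimately have "(\<Sum>G\<in>?I. (-1) ^ (card G - 1)) = ((-1) ^ (card F - 1) :: real)"
    by simp
  \<comment> \<open>A further sign passes from dimensions to cardinalities; all cardinalities
    involved are positive, so the subtraction of 1 is genuine.\<close>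
  then have "(\<Sum>G\<in>?I. (-1) * (-1) ^ (card G - 1)) = ((-1) * (-1) ^ (card F - 1) :: real)"
    by (simp only: sum_distrib_left[symmetric])
  moreover have "(-1) * (-1) ^ (card G - 1) = ((-1) ^ card G :: real)" if "G \<in> ?I" for G
  proof -
    have "card G > 0" using I[OF that] finite_face by (simp add: card_gt_0_iff)
    then show ?thesis by (metis Suc_diff_1 power_Suc)
  qed
  moreover have "(-1) * (-1) ^ (card F - 1) = ((-1) ^ card F :: real)"
  proof -
    have "card F > 0" using False finite_sub[OF assms(1)] by (simp add: card_gt_0_iff)
    then show ?thesis by (metis Suc_diff_1 power_Suc)
  qed
  ultimately show ?thesis
    by (simp only: cong: sum.cong)
qed

text \<open>Otherwise the relative interior of \<open>\<sigma> F\<close> would be covered by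
  finitely many affine spaces of smaller dimension. This identifies the value of \<open>Max\<close>
  in \<open>h_poly\<close>.\<close>

lemma facet_exists:
  assumes "F \<subseteq> V"
  obtains G where "G \<in> res F" "card G = card F"
proof (cases "F = {}")
  case True
  then show ?thesis using that[of "{}"] empty_in_res by simp
next
  case False
  have "\<exists>G\<in>res F. card F \<le> card G"
  proof (rule ccontr)
    assume less: "\<not> (\<exists>G\<in>res F. card F \<le> card G)"
    have "\<not> rel_interior (\<sigma> F) \<subseteq> \<Union>((\<lambda>G. affine hull (\<tau> G)) ` res F)"
    proof (rule openin_affine_not_covered)
      show "finite ((\<lambda>G. affine hull (\<tau> G)) ` res F)" using finite_res by simp
      show "openin (top_of_set (affine hull (\<sigma> F))) (rel_interior (\<sigma> F))"
        by (rule openin_rel_interior)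
      show "rel_interior (\<sigma> F) \<noteq> {}" using False by (simp add: rel_interior_eq_empty)
      show "affine L \<and> aff_dim L < aff_dim (affine hull (\<sigma> F))"
        if "L \<in> (\<lambda>G. affine hull (\<tau> G)) ` res F" for L
        using that less res_subset_\<Gamma>
        by (auto simp: aff_dim_\<tau> aff_dim_\<sigma>[OF assms] affine_affine_hull simp del: affine_hull_convex_hull)
    qed (simp add: affine_affine_hull)
    moreover have "rel_interior (\<sigma> F) \<subseteq> \<Union>((\<lambda>G. affine hull (\<tau> G)) ` res F)"
    proof
      fix x assume "x \<in> rel_interior (\<sigma> F)"
      then have "x \<in> \<sigma> F" by (rule subsetD[OF rel_interior_subset])
      then obtain G where G: "G \<in> res F" "x \<in> rel_interior (\<tau> G)"
        using carrier_exists[OF assms] by blast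
      then have "x \<in> affine hull (\<tau> G)"
        by (intro subsetD[OF order_trans[OF rel_interior_subset hull_subset]])
      then show "x \<in> \<Union>((\<lambda>G. affine hull (\<tau> G)) ` res F)"
        by (rule UN_I[OF G(1)])
    qed
    ultimately show False by contradiction
  qed
  then show ?thesis using that card_res_le[OF assms] by (meson le_antisym)
qed

text \<open>A face lying over both \<open>E\<close> and \<open>E'\<close> lies over
  \<open>E \<inter> E'\<close>, which by interiority is proper in neither.\<close>

lemma carrier_unique:
  assumes "E \<subseteq> V" "E' \<subseteq> V" "G \<in> int_faces E" "G \<in> int_faces E'"
  shows "E = E'"
proof -
  have "G \<in> res (E \<inter> E')"
    using assms by (intro res_Int) (simp_all add: int_faces_iff)
  then have "\<not> E \<inter> E' \<subset> E" "\<not> E \<inter> E' \<subset> E'"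
    using assms(3,4) by (auto simp only: int_faces_iff)
  then show ?thesis by blast
qed

text \<open>The carrier is a face of the simplex of least cardinality over which \<open>G\<close>
  lies.\<close>

lemma int_face_exists:
  assumes "F \<subseteq> V" "G \<in> res F"
  obtains E where "E \<subseteq> F" "G \<in> int_faces E"
proof -
  have "F \<subseteq> F \<and> G \<in> res F" using assms(2) by simp
  from ex_has_least_nat[of "\<lambda>E. E \<subseteq> F \<and> G \<in> res E", OF this]
  obtain E where E: "E \<subseteq> F" "G \<in> res E"
    and min: "\<And>E'. E' \<subseteq> F \<Longrightarrow> G \<in> res E' \<Longrightarrow> card E \<le> card E'"
    by metis
  have "finite E" using E(1) assms(1) finite_sub by blast
  then have "G \<notin> res E'" if "E' \<subset> E" for E'
    using min[of E'] E(1) that psubset_card_mono[of E E'] by fastforce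
  then show ?thesis using that E by (auto simp: int_faces_iff)
qed

text \<open>Sorts the boundary faces by carrier, which is the source of the recurrence between theta
  and interior h-polynomials.\<close>

lemma bd_eq_UN: "F \<subseteq> V \<Longrightarrow> bd F = (\<Union>E\<in>{E. E \<subset> F}. int_faces E)"
proof
  assume "F \<subseteq> V"
  show "bd F \<subseteq> (\<Union>E\<in>{E. E \<subset> F}. int_faces E)"
  proof
    fix G assume "G \<in> bd F"
    then obtain E where E: "E \<subset> F" "G \<in> res E" unfolding boundary_restriction_def by blast
    then obtain E' where "E' \<subseteq> E" "G \<in> int_faces E'"
      using int_face_exists[of E G] \<open>F \<subseteq> V\<close> by blast
    then show "G \<in> (\<Union>E\<in>{E. E \<subset> F}. int_faces E)"
      using E(1) by (intro UN_I[of E']) auto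
  qed
  show "(\<Union>E\<in>{E. E \<subset> F}. int_faces E) \<subseteq> bd F"
    unfolding boundary_restriction_def by (rule UN_mono) (simp_all add: interior_faces_def)
qed

end

section \<open>Interior h-polynomials and symmetry of theta polynomials\<close>

text \<open>The contribution of one face to the h-polynomial of a complex of dimension
  \<open>d - 1\<close>. Sums over faces can be split and reordered more directly than sums over face
  numbers.\<close>

definition face_term :: "nat \<Rightarrow> 'b set \<Rightarrow> real poly" where
  "face_term d G = monom 1 (card G) * [:1, -1:] ^ (d - card G)"

lemma poly_face_term: "poly (face_term d G) x = x ^ card G * (1 - x) ^ (d - card G)"
  by (simp add: face_term_def poly_monom)

lemma degree_face_term: "card G \<le> d \<Longrightarrow> degree (face_term d G) \<le> d"
proof -
  assume "card G \<le> d"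
  have "degree (face_term d G) \<le> degree (monom (1::real) (card G)) + degree ([:1, -1::real:] ^ (d - card G))"
    unfolding face_term_def by (rule degree_mult_le)
  also have "\<dots> \<le> card G + (d - card G)"
    using degree_power_le[of "[:1, -1::real:]" "d - card G"] by (intro add_mono degree_monom_le) simp
  finally show ?thesis using \<open>card G \<le> d\<close> by simp
qed

lemma face_term_shift:
  assumes "card G \<le> d" "d \<le> e"
  shows "face_term e G = [:1, -1:] ^ (e - d) * face_term d G"
proof -
  have "e - card G = (e - d) + (d - card G)" using assms by simp
  then show ?thesis by (simp add: face_term_def power_add mult.left_commute)
qed

lemma h_poly_eq_sum_faces:
  assumes "finite \<Delta>" "Max (card ` \<Delta>) = d"
  shows "h_poly \<Delta> = (\<Sum>G\<in>\<Delta>. face_term d G)"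
proof -
  have "card ` \<Delta> \<subseteq> {..d}"
    using assms Max_ge[of "card ` \<Delta>"] by auto
  then have "(\<Sum>G\<in>\<Delta>. face_term d G) = (\<Sum>i\<le>d. \<Sum>G | G \<in> \<Delta> \<and> card G = i. face_term d G)"
    using assms(1) by (intro sum.group[symmetric]) auto
  also have "\<dots> = (\<Sum>i\<le>d. smult (real (face_number \<Delta> i)) (monom 1 i * [:1, -1:] ^ (d - i)))"
  proof (rule sum.cong)
    fix i
    have "(\<Sum>G | G \<in> \<Delta> \<and> card G = i. face_term d G) = (\<Sum>G | G \<in> \<Delta> \<and> card G = i. monom 1 i * [:1, -1:] ^ (d - i))"
      by (intro sum.cong) (auto simp: face_term_def)
    then show "(\<Sum>G | G \<in> \<Delta> \<and> card G = i. face_term d G) = smult (real (face_number \<Delta> i)) (monom 1 i * [:1, -1:] ^ (d - i))"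
      by (simp add: face_number_def of_nat_poly)
  qed simp
  finally show ?thesis
    by (simp add: h_poly_def assms(2) Let_def)
qed

text \<open>A nonzero polynomial has finitely many roots; identities can thus be checked where
  division by \<open>x\<close> or \<open>x - 1\<close> is legitimate.\<close>

lemma poly_eqI_cofinite:
  fixes p q :: "real poly"
  assumes "finite S" "\<And>x. x \<notin> S \<Longrightarrow> poly p x = poly q x"
  shows "p = q"
proof (rule ccontr)
  assume "p \<noteq> q"
  then have "finite {x. poly (p - q) x = 0}"
    by (intro poly_roots_finite) simp
  moreover have "UNIV \<subseteq> {x. poly (p - q) x = 0} \<union> S"
    using assms(2) by auto
  ultimately show False
    using assms(1) infinite_UNIV_char_0[where ?'a = real] by (metis finite_Un finite_subset)
qed

lemma coeff_reverse_poly: "coeff (reverse_poly m p) k = (if k \<le> m then coeff p (m - k) else 0)"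
proof -
  have "coeff (reverse_poly m p) k = (\<Sum>i\<le>m. if i = m - k \<and> k \<le> m then coeff p i else 0)"
    unfolding reverse_poly_def coeff_sum by (intro sum.cong) auto
  then show ?thesis by (cases "k \<le> m") (auto cong: sum.cong)
qed

text \<open>The degree bound comes for free, because the reversal has no coefficients beyond
  \<open>m\<close>.\<close>

lemma symmetric_polyI:
  assumes "reverse_poly m p = p"
  shows "symmetric_poly m p"
proof -
  have c: "coeff p k = (if k \<le> m then coeff p (m - k) else 0)" for k
    using coeff_reverse_poly[of m p k] assms by simp
  then have "degree p \<le> m"
    by (intro degree_le allI impI) (metis linorder_not_less)
  moreover have "coeff p i = coeff p (m - i)" if "i \<le> m" for i
    using c[of i] that by metis
  ultimately show ?thesis
    unfolding symmetric_poly_def by blast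
qed

lemma sum_Pow_power_card:
  fixes y :: real
  assumes "finite G"
  shows "(\<Sum>H\<in>Pow G. y ^ (card G - card H)) = (1 + y) ^ card G"
proof -
  have "(1 + y) ^ card G = (\<Prod>x\<in>G. 1 + y)" by simp
  also have "\<dots> = (\<Sum>H\<in>Pow G. y ^ card (G - H))"
    by (subst prod_add[OF assms]) simp
  also have "\<dots> = (\<Sum>H\<in>Pow G. y ^ (card G - card H))"
    using assms by (intro sum.cong) (auto simp: card_Diff_subset finite_subset)
  finally show ?thesis ..
qed

text \<open>Turns a sum over the proper faces of \<open>F\<close> into a binomial sum; uniformity
  makes the summands depend on cardinalities only.\<close>

lemma sum_psubsets_by_card:
  fixes \<phi> :: "nat \<Rightarrow> real poly"
  assumes "finite F"
  shows "(\<Sum>E | E \<subset> F. \<phi> (card E)) = (\<Sum>k<card F. smult (real (card F choose k)) (\<phi> k))"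
proof -
  have fin: "finite {E. E \<subset> F}" using assms by (rule finite_subset[rotated, OF finite_Collect_subsets]) auto
  have "(\<Sum>E | E \<subset> F. \<phi> (card E)) = (\<Sum>k<card F. \<Sum>E | E \<in> {E. E \<subset> F} \<and> card E = k. \<phi> (card E))"
    using psubset_card_mono[OF assms] by (intro sum.group[symmetric] fin) auto
  also have "\<dots> = (\<Sum>k<card F. smult (real (card F choose k)) (\<phi> k))"
  proof (rule sum.cong)
    fix k assume "k \<in> {..<card F}"
    then have "{E. E \<in> {E. E \<subset> F} \<and> card E = k} = {E. E \<subseteq> F \<and> card E = k}" by auto
    then show "(\<Sum>E | E \<in> {E. E \<subset> F} \<and> card E = k. \<phi> (card E)) = smult (real (card F choose k)) (\<phi> k)"
      using n_subsets[OF assms, of k] by (simp add: of_nat_poly)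
  qed simp
  finally show ?thesis .
qed

section \<open>h-polynomials of restrictions, their boundaries and their interiors\<close>

context simplex_triangulation
begin

definition interior_h :: "'a set \<Rightarrow> real poly" where
  "interior_h F = (\<Sum>G\<in>int_faces F. face_term (card F) G)"

lemma h_poly_res:
  assumes "F \<subseteq> V"
  shows "h_poly (res F) = (\<Sum>G\<in>res F. face_term (card F) G)"
proof (intro h_poly_eq_sum_faces finite_res Max_eqI)
  obtain G where "G \<in> res F" "card G = card F" using facet_exists[OF assms] by blast
  then show "card F \<in> card ` res F" by force
  show "y \<le> card F" if "y \<in> card ` res F" for y
    using that by (elim imageE) (simp add: card_res_le[OF assms])
qed (simp add: finite_res)

lemma card_bd_le:
  assumes "F \<subseteq> V" "G \<in> bd F"
  shows "card G \<le> card F - 1"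
proof -
  obtain E where E: "E \<subset> F" "G \<in> res E"
    using assms(2) unfolding boundary_restriction_def by blast
  then have "card G \<le> card E" using assms(1) by (intro card_res_le) auto
  also have "card E < card F" using E(1) psubset_card_mono finite_sub[OF assms(1)] by blast
  finally show ?thesis by simp
qed

lemma bd_subset_res: "bd F \<subseteq> res F"
  unfolding boundary_restriction_def using res_mono by (intro UN_least) (simp add: psubset_imp_subset)

lemma finite_bd: "finite (bd F)"
  using finite_subset[OF bd_subset_res finite_res] .

lemma h_poly_bd:
  assumes "F \<subseteq> V" "F \<noteq> {}"
  shows "h_poly (bd F) = (\<Sum>G\<in>bd F. face_term (card F - 1) G)"
proof (intro h_poly_eq_sum_faces finite_bd Max_eqI)
  \<comment> \<open>A facet over \<open>F\<close> minus one vertex shows that the boundary complex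
    attains \<open>card F - 1\<close> vertices.\<close>
  obtain v where v: "v \<in> F" using assms(2) by blast
  then obtain G where G: "G \<in> res (F - {v})" "card G = card (F - {v})"
    using facet_exists[of "F - {v}"] assms(1) by blast
  have "G \<in> bd F"
    unfolding boundary_restriction_def using v G(1) by (intro UN_I[of "F - {v}"]) auto
  moreover have "card G = card F - 1"
    using G(2) v finite_sub[OF assms(1)] by simp
  ultimately show "card F - 1 \<in> card ` bd F" by force
  show "y \<le> card F - 1" if "y \<in> card ` bd F" for y
    using that by (elim imageE) (simp only: card_bd_le[OF assms(1)])
qed (simp add: finite_bd)

lemma degree_h_poly_res:
  assumes "F \<subseteq> V"
  shows "degree (h_poly (res F)) \<le> card F"
  unfolding h_poly_res[OF assms]
  by (rule degree_sum_le[OF finite_res degree_face_term[OF card_res_le[OF assms]]])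

lemma degree_h_poly_bd:
  assumes "F \<subseteq> V" "F \<noteq> {}"
  shows "degree (h_poly (bd F)) \<le> card F - 1"
  unfolding h_poly_bd[OF assms]
  by (rule degree_sum_le[OF finite_bd degree_face_term[OF card_bd_le[OF assms(1)]]])

text \<open>Substituting \<open>1 / x\<close> gives the sum of \<open>(x - 1) ^ (m - card H)\<close>
  over all faces \<open>H\<close>. The local Euler relation rewrites it over pairs of a face and an
  interior face above it, and summing over the lower face first leaves the interior terms.\<close>

theorem reverse_h_poly_res:
  assumes "F \<subseteq> V"
  shows "reverse_poly (card F) (h_poly (res F)) = interior_h F"
proof (rule poly_eqI_cofinite[of "{0}"])
  fix x :: real assume "x \<notin> {0}"
  let ?m = "card F"
  have x: "x \<noteq> 0" using \<open>x \<notin> {0}\<close> by simp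
  have "poly (reverse_poly ?m (h_poly (res F))) x = x ^ ?m * (\<Sum>H\<in>res F. (1 / x) ^ card H * (1 - 1 / x) ^ (?m - card H))"
    using poly_reverse_poly[OF degree_h_poly_res[OF assms] x]
    by (simp add: h_poly_res[OF assms] poly_sum poly_face_term)
  also have "\<dots> = (\<Sum>H\<in>res F. (x - 1) ^ (?m - card H))"
    unfolding sum_distrib_left
  proof (rule sum.cong)
    fix H assume "H \<in> res F"
    then have "?m = card H + (?m - card H)" using card_res_le[OF assms] by simp
    then have "x ^ ?m = x ^ card H * x ^ (?m - card H)" by (metis power_add)
    then have "x ^ ?m * ((1 / x) ^ card H * (1 - 1 / x) ^ (?m - card H))
       = (x * (1 / x)) ^ card H * (x * (1 - 1 / x)) ^ (?m - card H)"
      by (simp only: power_mult_distrib mult_ac)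
    then show "x ^ ?m * ((1 / x) ^ card H * (1 - 1 / x) ^ (?m - card H)) = (x - 1) ^ (?m - card H)"
      using x by (simp add: right_diff_distrib)
  qed simp
  \<comment> \<open>Each summand is multiplied by 1, written as \<open>(-1) ^ m\<close> times the
    alternating sum of the local Euler relation.\<close>
  also have "\<dots> = (\<Sum>H\<in>res F. \<Sum>G\<in>{G\<in>int_faces F. H \<subseteq> G}. (-1) ^ ?m * (-1) ^ card G * (x - 1) ^ (?m - card H))"
  proof (rule sum.cong)
    fix H assume "H \<in> res F"
    have "(\<Sum>G\<in>{G\<in>int_faces F. H \<subseteq> G}. (-1) ^ ?m * (-1) ^ card G * (x - 1) ^ (?m - card H))
      = (-1) ^ ?m * (\<Sum>G\<in>{G\<in>int_faces F. H \<subseteq> G}. (-1) ^ card G) * (x - 1) ^ (?m - card H)"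
      by (simp only: sum_distrib_left sum_distrib_right mult_ac)
    also have "\<dots> = (x - 1) ^ (?m - card H)"
      unfolding local_euler_relation[OF assms \<open>H \<in> res F\<close>] by (simp flip: power_add)
    finally show "(x - 1) ^ (?m - card H) = (\<Sum>G\<in>{G\<in>int_faces F. H \<subseteq> G}. (-1) ^ ?m * (-1) ^ card G * (x - 1) ^ (?m - card H))" ..
  qed simp
  also have "\<dots> = (\<Sum>G\<in>int_faces F. \<Sum>H\<in>{H\<in>res F. H \<subseteq> G}. (-1) ^ ?m * (-1) ^ card G * (x - 1) ^ (?m - card H))"
    by (rule sum.swap_restrict[OF finite_res finite_int_faces])
  also have "\<dots> = (\<Sum>G\<in>int_faces F. x ^ card G * (1 - x) ^ (?m - card G))"
  proof (rule sum.cong)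
    fix G assume G: "G \<in> int_faces F"
    then have GF: "G \<in> res F" by (simp add: int_faces_iff)
    then have fin: "finite G" using finite_face res_subset_\<Gamma> by blast
    have le: "card G \<le> ?m" using card_res_le[OF assms GF] .
    have P: "{H\<in>res F. H \<subseteq> G} = Pow G" using res_down[OF GF] by auto
    have "(\<Sum>H\<in>Pow G. (-1) ^ ?m * (-1) ^ card G * (x - 1) ^ (?m - card H))
       = (\<Sum>H\<in>Pow G. (1 - x) ^ (?m - card G) * (x - 1) ^ (card G - card H))"
    proof (rule sum.cong)
      fix H assume "H \<in> Pow G"
      then have "card H \<le> card G" using fin by (simp add: card_mono)
      then have "?m - card H = (?m - card G) + (card G - card H)" using le by simp
      then have 1: "(x - 1) ^ (?m - card H) = (x - 1) ^ (?m - card G) * (x - 1) ^ (card G - card H)"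
        by (simp add: power_add)
      have "(-1) ^ ?m * (-1) ^ card G = ((-1) ^ (?m - card G) :: real)"
        using le by (metis neg_one_power_add_eq_neg_one_power_diff power_add)
      then have "(-1) ^ ?m * (-1) ^ card G * (x - 1) ^ (?m - card G) = (1 - x) ^ (?m - card G)"
        by (simp flip: power_mult_distrib)
      then show "(-1) ^ ?m * (-1) ^ card G * (x - 1) ^ (?m - card H) = (1 - x) ^ (?m - card G) * (x - 1) ^ (card G - card H)"
        unfolding 1 by (simp only: mult.assoc[symmetric])
    qed simp
    \<comment> \<open>The binomial theorem over the subsets of \<open>G\<close>, with
      \<open>1 + (x - 1) = x\<close>.\<close>
    also have "\<dots> = (1 - x) ^ (?m - card G) * x ^ card G"
      using sum_Pow_power_card[OF fin, of "x - 1"] by (simp flip: sum_distrib_left)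
    finally show "(\<Sum>H\<in>{H\<in>res F. H \<subseteq> G}. (-1) ^ ?m * (-1) ^ card G * (x - 1) ^ (?m - card H)) = x ^ card G * (1 - x) ^ (?m - card G)"
      unfolding P by (simp only: mult.commute)
  qed simp
  also have "\<dots> = poly (interior_h F) x"
    by (simp add: interior_h_def poly_sum poly_face_term)
  finally show "poly (reverse_poly ?m (h_poly (res F))) x = poly (interior_h F) x" .
qed simp

text \<open>The boundary complex has one dimension less, so each of its faces contributes an
  additional factor \<open>1 - x\<close> to the h-polynomial of the whole.\<close>

lemma h_poly_res_split:
  assumes "F \<subseteq> V" "F \<noteq> {}"
  shows "h_poly (res F) = interior_h F + [:1, -1:] * h_poly (bd F)"
proof -
  have pos: "card F \<ge> 1"
    using assms finite_sub[OF assms(1)] by (simp add: Suc_le_eq card_gt_0_iff)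
  have "h_poly (res F) = (\<Sum>G\<in>int_faces F. face_term (card F) G) + (\<Sum>G\<in>bd F. face_term (card F) G)"
    unfolding h_poly_res[OF assms(1)] interior_faces_def
    by (rule sum.subset_diff[OF bd_subset_res finite_res])
  also have "(\<Sum>G\<in>bd F. face_term (card F) G) = [:1, -1:] * h_poly (bd F)"
    unfolding h_poly_bd[OF assms] sum_distrib_left
  proof (rule sum.cong)
    fix G assume "G \<in> bd F"
    then show "face_term (card F) G = [:1, -1:] * face_term (card F - 1) G"
      using face_term_shift[OF card_bd_le[OF assms(1)], of G "card F"] pos by simp
  qed simp
  finally show ?thesis by (simp only: interior_h_def)
qed

text \<open>Boundary faces are grouped by carrier \<open>E\<close>; the power of
  \<open>1 - x\<close> accounts for the gap between \<open>card E\<close> and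
  \<open>card F - 1\<close>.\<close>

lemma h_poly_bd_sum:
  assumes "F \<subseteq> V" "F \<noteq> {}"
  shows "h_poly (bd F) = (\<Sum>E | E \<subset> F. [:1, -1:] ^ (card F - 1 - card E) * interior_h E)"
proof -
  have fin: "finite {E. E \<subset> F}"
    using finite_sub[OF assms(1)] by (rule finite_subset[rotated, OF finite_Collect_subsets]) auto
  have "h_poly (bd F) = (\<Sum>E | E \<subset> F. \<Sum>G\<in>int_faces E. face_term (card F - 1) G)"
    unfolding h_poly_bd[OF assms] unfolding bd_eq_UN[OF assms(1)]
  proof (rule sum.UNION_disjoint[OF fin])
    show "\<forall>E\<in>{E. E \<subset> F}. \<forall>E'\<in>{E. E \<subset> F}. E \<noteq> E' \<longrightarrow> int_faces E \<inter> int_faces E' = {}"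
    proof (intro ballI impI)
      fix E E' assume "E \<in> {E. E \<subset> F}" "E' \<in> {E. E \<subset> F}" "E \<noteq> E'"
      then show "int_faces E \<inter> int_faces E' = {}"
        using carrier_unique[of E E'] assms(1) by auto
    qed
  qed (simp add: finite_int_faces)
  also have "\<dots> = (\<Sum>E | E \<subset> F. [:1, -1:] ^ (card F - 1 - card E) * interior_h E)"
    unfolding interior_h_def sum_distrib_left
  proof (intro sum.cong refl)
    fix E G assume E: "E \<in> {E. E \<subset> F}" and G: "G \<in> int_faces E"
    have "card G \<le> card E"
      using E G assms(1) by (intro card_res_le) (auto simp: int_faces_iff)
    moreover have "card E < card F"
      using E psubset_card_mono[OF finite_sub[OF assms(1)]] by simp
    ultimately show "face_term (card F - 1) G = [:1, -1:] ^ (card F - 1 - card E) * face_term (card E) G"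
      by (intro face_term_shift) auto
  qed
  finally show ?thesis .
qed

lemma theta_poly_eq:
  assumes "F \<subseteq> V" "F \<noteq> {}"
  shows "theta_poly s \<Gamma> r F = interior_h F - [:0, 1:] * h_poly (bd F)"
proof -
  have "[:1, -1:] = 1 - [:0, 1::real:]" by (simp add: one_pCons)
  then have "[:1, -1:] * h_poly (bd F) = h_poly (bd F) - [:0, 1:] * h_poly (bd F)"
    by (simp only: left_diff_distrib mult_1)
  then show ?thesis
    using assms(2) h_poly_res_split[OF assms] by (simp add: theta_poly_def)
qed

lemma interior_h_empty: "interior_h {} = 1"
proof -
  have "int_faces {} = {{}}"
    by (simp add: interior_faces_def boundary_restriction_def res_empty)
  then show ?thesis by (simp add: interior_h_def face_term_def)
qed

text \<open>Write \<open>h = g + (1 - x) D\<close> with \<open>D\<close> the boundary h-polynomial.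
  Reversal exchanges \<open>h\<close> and \<open>g\<close>, so comparing this identity with its
  reversal shows that \<open>D\<close> reverses to \<open>x D\<close>. Hence \<open>h - D\<close>
  reverses to \<open>g - x D\<close>, which is the theta polynomial again.\<close>

theorem symmetric_theta_poly:
  assumes "F \<subseteq> V"
  shows "symmetric_poly (card F) (theta_poly s \<Gamma> r F)"
proof (cases "F = {}")
  case True
  then show ?thesis by (simp add: theta_poly_def symmetric_poly_def)
next
  case False
  let ?m = "card F" and ?h = "h_poly (res F)" and ?g = "interior_h F" and ?D = "h_poly (bd F)"
    and ?\<theta> = "theta_poly s \<Gamma> r F"
  have \<theta>: "?\<theta> = ?h - ?D" using False by (simp add: theta_poly_def)
  have deg: "degree ?\<theta> \<le> ?m"
    unfolding \<theta> using degree_h_poly_res[OF assms] degree_h_poly_bd[OF assms False]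
    by (intro degree_diff_le) auto
  have "reverse_poly ?m ?\<theta> = ?\<theta>"
  proof (rule poly_eqI_cofinite[of "{0, 1}"])
    fix x :: real assume "x \<notin> {0, 1}"
    then have x: "x \<noteq> 0" "x \<noteq> 1" by auto
    have gh: "poly ?g y = y ^ ?m * poly ?h (1 / y)" if "y \<noteq> 0" for y
      using poly_reverse_poly[OF degree_h_poly_res[OF assms] that]
      by (simp add: reverse_h_poly_res[OF assms])
    have hgD: "poly ?h y = poly ?g y + (1 - y) * poly ?D y" for y
      using h_poly_res_split[OF assms False] by (simp add: algebra_simps)
    have "poly ?g (1 / x) = (1 / x) ^ ?m * poly ?h x"
      using gh[of "1 / x"] x by simp
    then have hx: "x ^ ?m * poly ?g (1 / x) = poly ?h x"
      using x by (simp add: power_one_over)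
    \<comment> \<open>The splitting of \<open>h\<close> at \<open>1 / x\<close>, multiplied by
      \<open>x ^ m\<close>.\<close>
    have "poly ?g x = x ^ ?m * poly ?g (1 / x) + (1 - 1 / x) * (x ^ ?m * poly ?D (1 / x))"
      using gh[OF x(1)] hgD[of "1 / x"] by (simp add: algebra_simps)
    then have "0 = (1 - x) * poly ?D x + (1 - 1 / x) * (x ^ ?m * poly ?D (1 / x))"
      unfolding hx using hgD[of x] by simp
    then have "(x - 1) * poly ?D x = (1 - 1 / x) * (x ^ ?m * poly ?D (1 / x))"
      by (simp add: algebra_simps)
    then have "x * ((x - 1) * poly ?D x) = x * ((1 - 1 / x) * (x ^ ?m * poly ?D (1 / x)))"
      by (rule arg_cong)
    also have "\<dots> = (x - 1) * (x ^ ?m * poly ?D (1 / x))"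
      using x by (simp add: field_simps)
    finally have "(x - 1) * (x * poly ?D x) = (x - 1) * (x ^ ?m * poly ?D (1 / x))"
      by (simp only: mult.left_commute)
    then have D: "x ^ ?m * poly ?D (1 / x) = x * poly ?D x"
      using x by simp
    have "poly (reverse_poly ?m ?\<theta>) x = x ^ ?m * poly ?h (1 / x) - x ^ ?m * poly ?D (1 / x)"
      using poly_reverse_poly[OF deg x(1)] by (simp add: \<theta> right_diff_distrib)
    also have "\<dots> = poly ?\<theta> x"
      unfolding D using gh[OF x(1)] theta_poly_eq[OF assms False] by simp
    finally show "poly (reverse_poly ?m ?\<theta>) x = poly ?\<theta> x" .
  qed simp
  then show ?thesis by (rule symmetric_polyI)
qed

end

section \<open>Multiplicative cones of polynomials and Eulerian series\<close>

text \<open>\<open>K m p\<close> means that \<open>p\<close> lies in the cone with center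
  \<open>m / 2\<close>; thus \<open>x\<close> has grade 2 and \<open>1 + x\<close> has grade 1.
  Gamma-positive and symmetric unimodal polynomials are both instances, so one argument serves both
  claims.\<close>

locale poly_cone =
  fixes K :: "nat \<Rightarrow> real poly \<Rightarrow> bool"
  assumes zero: "K m 0"
    and add: "K m p \<Longrightarrow> K m q \<Longrightarrow> K m (p + q)"
    and smult: "0 \<le> c \<Longrightarrow> K m p \<Longrightarrow> K m (smult c p)"
    and mult: "K a p \<Longrightarrow> K b q \<Longrightarrow> K (a + b) (p * q)"
    and one: "K 0 1"
    and one_plus_X: "K 1 [:1, 1:]"
    and X: "K 2 [:0, 1:]"
begin

lemma sum: "(\<And>i. i \<in> A \<Longrightarrow> K m (f i)) \<Longrightarrow> K m (\<Sum>i\<in>A. f i)"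
  by (induction A rule: infinite_finite_induct) (auto intro: zero add)

lemma of_nat_mult: "K m p \<Longrightarrow> K m (of_nat c * p)"
  using smult[of "of_nat c" m p] by (simp add: of_nat_poly)

text \<open>Recovers a coefficient of a series from the corresponding coefficient of its
  derivative.\<close>

lemma of_nat_mult_cancel: "K m (of_nat (Suc c) * p) \<Longrightarrow> K m p"
proof -
  assume "K m (of_nat (Suc c) * p)"
  then have "K m (smult (1 / of_nat (Suc c)) (of_nat (Suc c) * p))"
    by (rule smult[rotated]) simp
  also have "smult (1 / of_nat (Suc c)) (of_nat (Suc c) * p) = p"
    by (simp only: of_nat_poly) simp
  finally show ?thesis .
qed

text \<open>The coefficient of \<open>t\<^sup>v\<close> is required to have center \<open>(v + d) / 2\<close>.\<close>

definition fps_cone :: "nat \<Rightarrow> real poly fps \<Rightarrow> bool" where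
  "fps_cone d F \<longleftrightarrow> (\<forall>v. K (v + d) (fps_nth F v))"

lemma fps_cone_0: "fps_cone d 0"
  by (simp add: fps_cone_def zero)

lemma fps_cone_add: "fps_cone d F \<Longrightarrow> fps_cone d G \<Longrightarrow> fps_cone d (F + G)"
  by (simp add: fps_cone_def add)

text \<open>Only coefficients up to \<open>v\<close> are assumed to be in the cones, so that the
  lemma can be used inside inductions on the coefficient index.\<close>

lemma fps_cone_mult_nth:
  assumes "\<And>i. i \<le> v \<Longrightarrow> K (i + d) (fps_nth F i)" "\<And>i. i \<le> v \<Longrightarrow> K (i + e) (fps_nth G i)"
  shows "K (v + (d + e)) (fps_nth (F * G) v)"
  unfolding fps_mult_nth
proof (rule sum)
  fix i assume "i \<in> {0..v}"
  then have "K ((i + d) + ((v - i) + e)) (fps_nth F i * fps_nth G (v - i))"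
    using assms \<open>i \<in> {0..v}\<close> by (intro mult assms) simp_all
  then show "K (v + (d + e)) (fps_nth F i * fps_nth G (v - i))"
    using \<open>i \<in> {0..v}\<close> by (simp add: algebra_simps)
qed

lemma fps_cone_mult: "fps_cone d F \<Longrightarrow> fps_cone e G \<Longrightarrow> fps_cone (d + e) (F * G)"
  using fps_cone_mult_nth unfolding fps_cone_def by blast

lemma fps_cone_const: "K d p \<Longrightarrow> fps_cone d (fps_const p)"
  by (simp add: fps_cone_def fps_const_def zero)

text \<open>Differentiation moves coefficient \<open>v + 1\<close> to position \<open>v\<close>,
  which raises the offset of the grading by one.\<close>

lemma fps_cone_deriv: "fps_cone d F \<Longrightarrow> fps_cone (Suc d) (fps_deriv F)"
proof -
  assume "fps_cone d F"
  then have "K (v + Suc d) (fps_nth F (v + 1))" for v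
    unfolding fps_cone_def by (metis add_Suc_right add_Suc_shift Suc_eq_plus1)
  then show ?thesis
    unfolding fps_cone_def fps_deriv_nth using of_nat_mult by blast
qed

lemma fps_cone_deriv_pow: "fps_cone d F \<Longrightarrow> fps_cone (u + d) ((fps_deriv ^^ u) F)"
  by (induction u) (auto intro: fps_cone_deriv)

end

section \<open>The Eulerian series in \<open>t\<close>, with \<open>x\<close> as a coefficient, and
  its differential equations\<close>

definition fps_x :: "real poly fps" where
  "fps_x = fps_const [:0, 1:]"

lemma fps_deriv_x [simp]: "fps_deriv fps_x = 0"
  by (simp add: fps_x_def)

lemma one_plus_fps_x: "1 + fps_x = fps_const [:1, 1:]"
  by (rule fps_ext) (auto simp: one_pCons fps_x_def)

lemma one_minus_fps_x: "1 - fps_x = fps_const [:1, -1:]"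
  by (rule fps_ext) (auto simp: one_pCons fps_x_def)

definition fps_e :: "real poly fps" where
  "fps_e = Abs_fps (\<lambda>k. [:1 / fact k:])"

text \<open>This is \<open>x (e\<^sup>(\<^sup>1\<^sup>-\<^sup>x\<^sup>)\<^sup>t - 1) / (1 - x)\<close>.\<close>

definition boundary_fps :: "real poly fps" where
  "boundary_fps = Abs_fps (\<lambda>k. if k = 0 then 0 else smult (1 / fact k) ([:0, 1:] * [:1, -1:] ^ (k - 1)))"

text \<open>This is \<open>C\<close> of the overview, since \<open>1 - boundary_fps\<close> equals
  \<open>(1 - x e\<^sup>(\<^sup>1\<^sup>-\<^sup>x\<^sup>)\<^sup>t) / (1 - x)\<close>. The
  coefficients form only a ring, and the second argument is the inverse of the constant coefficient
  1.\<close>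

definition eulerian_fps :: "real poly fps" where
  "eulerian_fps = fps_left_inverse (1 - boundary_fps) 1"

text \<open>Dropping the constant term 1, whose center is 0, gives a series in which the coefficient
  of \<open>t\<^sup>v\<close> has center \<open>(v + 1) / 2\<close>.\<close>

definition eulerian_tail :: "real poly fps" where
  "eulerian_tail = eulerian_fps - 1"

lemma eulerian_fps_inverse: "eulerian_fps * (1 - boundary_fps) = 1"
  unfolding eulerian_fps_def
  by (rule fps_left_inverse) (simp add: boundary_fps_def)

lemma fps_deriv_e: "fps_deriv fps_e = fps_e"
  by (rule fps_ext) (simp add: fps_e_def of_nat_poly del: of_nat_Suc)

lemma fps_deriv_boundary:
  "fps_deriv boundary_fps = fps_x + (1 - fps_x) * boundary_fps"
proof (rule fps_ext)
  fix v
  have "fps_nth (fps_x + (1 - fps_x) * boundary_fps) v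
     = (if v = 0 then [:0, 1:] else 0) + [:1, -1:] * fps_nth boundary_fps v"
    unfolding one_minus_fps_x by (simp add: fps_x_def)
  also have "\<dots> = fps_nth (fps_deriv boundary_fps) v"
  proof (cases v)
    case (Suc w)
    have "of_nat (Suc v) * smult (1 / fact (Suc v)) p = smult (1 / fact v) p" for p :: "real poly"
      by (simp add: of_nat_poly del: of_nat_Suc)
    then show ?thesis
      using Suc by (simp add: boundary_fps_def mult.left_commute del: of_nat_Suc mult_pCons_left fact_Suc)
  qed (simp add: boundary_fps_def)
  finally show "fps_nth (fps_deriv boundary_fps) v = fps_nth (fps_x + (1 - fps_x) * boundary_fps) v"
    by simp
qed

text \<open>With \<open>E\<close> for \<open>boundary_fps\<close>, differentiating
  \<open>C (1 - E) = 1\<close> gives \<open>C' = C (C E')\<close>. Then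
  \<open>E' = x + (1 - x) E\<close> and \<open>C E = C - 1\<close> reduce \<open>C E'\<close> to
  \<open>x + T\<close>.\<close>

lemma fps_deriv_eulerian: "fps_deriv eulerian_fps = eulerian_fps * (fps_x + eulerian_tail)"
proof -
  let ?C = eulerian_fps and ?E = boundary_fps
  have E: "?C * ?E = ?C - 1"
    using eulerian_fps_inverse by (simp add: algebra_simps)
  have "fps_deriv (?C * (1 - ?E)) = 0"
    by (simp add: eulerian_fps_inverse)
  then have "fps_deriv ?C * (1 - ?E) = ?C * fps_deriv ?E"
    by (simp add: algebra_simps)
  then have "fps_deriv ?C * ((1 - ?E) * ?C) = ?C * (?C * fps_deriv ?E)"
    by (metis mult.commute mult.left_commute)
  also have "?C * fps_deriv ?E = fps_x * ?C + (1 - fps_x) * (?C * ?E)"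
    by (simp add: fps_deriv_boundary algebra_simps)
  also have "\<dots> = fps_x + eulerian_tail"
    unfolding E by (simp add: algebra_simps eulerian_tail_def)
  finally show ?thesis
    using eulerian_fps_inverse by (simp add: mult.commute)
qed

lemma eulerian_fps_nth_0: "fps_nth eulerian_fps 0 = 1"
  using arg_cong[OF eulerian_fps_inverse, of "\<lambda>F. fps_nth F 0"]
  by (simp add: boundary_fps_def)

lemma fps_deriv_eulerian_tail:
  "fps_deriv eulerian_tail = (1 + eulerian_tail) * (fps_x + eulerian_tail)"
  using fps_deriv_eulerian by (simp add: eulerian_tail_def)

section \<open>Cone membership of the Eulerian series and decomposition of derivatives\<close>

context poly_cone
begin

text \<open>The expanded equation \<open>T' = x + (1 + x) T + T T\<close> is a recurrence for the
  coefficients in which every term is positive and has the same grade.\<close>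

lemma fps_cone_eulerian_tail: "fps_cone 1 eulerian_tail"
  unfolding fps_cone_def
proof
  let ?T = eulerian_tail
  fix v
  show "K (v + 1) (fps_nth ?T v)"
  proof (induction v rule: less_induct)
    case (less v)
    show ?case
    proof (cases v)
      case 0
      then show ?thesis by (simp add: eulerian_tail_def eulerian_fps_nth_0 zero)
    next
      case (Suc w)
      have T: "K (i + 1) (fps_nth ?T i)" if "i \<le> w" for i
        using less that Suc by simp
      have "fps_deriv ?T = fps_x + fps_const [:1, 1:] * ?T + ?T * ?T"
        by (simp add: fps_deriv_eulerian_tail algebra_simps flip: one_plus_fps_x)
      then have eq: "fps_nth (fps_deriv ?T) w
          = fps_nth fps_x w + fps_nth (fps_const [:1, 1:] * ?T) w + fps_nth (?T * ?T) w"
        by simp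
      have "K (w + 2) (fps_nth fps_x w)"
        using X by (auto simp: fps_x_def zero numeral_2_eq_2)
      moreover have "K (w + (1 + 1)) (fps_nth (fps_const [:1, 1:] * ?T) w)"
        using fps_cone_const[OF one_plus_X] T unfolding fps_cone_def
        by (intro fps_cone_mult_nth) auto
      moreover have "K (w + (1 + 1)) (fps_nth (?T * ?T) w)"
        using T by (intro fps_cone_mult_nth) auto
      ultimately have "K (w + 2) (fps_nth (fps_deriv ?T) w)"
        unfolding eq by (intro add) (auto simp: numeral_2_eq_2)
      then show ?thesis
        using of_nat_mult_cancel[of _ w] Suc by (simp add: fps_deriv_nth del: of_nat_Suc fps_deriv_mult)
    qed
  qed
qed

lemma fps_cone_linear_plus_eulerian_tail: "fps_cone 1 (1 + fps_x + eulerian_tail)"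
  using fps_cone_add[OF fps_cone_const[OF one_plus_X] fps_cone_eulerian_tail]
  by (simp add: one_plus_fps_x)

text \<open>The series \<open>B = e\<^sup>t C\<close> starts at 1 and satisfies
  \<open>B' = B (1 + x + T)\<close>, whose second factor lies in the cone.\<close>

lemma fps_cone_binomial_eulerian: "fps_cone 0 (fps_e * eulerian_fps)"
  unfolding fps_cone_def
proof
  let ?B = "fps_e * eulerian_fps"
  fix v
  have eq: "fps_deriv ?B = ?B * (1 + fps_x + eulerian_tail)"
    by (simp add: fps_deriv_e fps_deriv_eulerian algebra_simps)
  show "K (v + 0) (fps_nth ?B v)"
  proof (induction v rule: less_induct)
    case (less v)
    show ?case
    proof (cases v)
      case 0
      then show ?thesis by (simp add: fps_e_def eulerian_fps_nth_0 one flip: one_pCons)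
    next
      case (Suc w)
      have "K (w + (0 + 1)) (fps_nth (fps_deriv ?B) w)"
        unfolding eq using less Suc fps_cone_linear_plus_eulerian_tail
        unfolding fps_cone_def by (intro fps_cone_mult_nth) auto
      then show ?thesis
        using of_nat_mult_cancel[of _ w] Suc by (simp add: fps_deriv_nth del: of_nat_Suc fps_deriv_mult)
    qed
  qed
qed

text \<open>Differentiating \<open>C (\<alpha> + (x + T) \<beta>)\<close> replaces
  \<open>\<alpha>\<close> by \<open>\<alpha>'\<close> and \<open>\<beta>\<close> by
  \<open>\<alpha> + (1 + x + 2 T) \<beta> + \<beta>'\<close>. The grade \<open>u - 1\<close> of
  \<open>\<beta>\<close> is meaningless for \<open>u = 0\<close>, where \<open>\<beta>\<close>
  vanishes.\<close>

lemma fps_deriv_pow_mult_eulerian: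
  assumes "fps_cone 0 \<Theta>"
  obtains \<beta> where
    "(fps_deriv ^^ u) (\<Theta> * eulerian_fps) =
       eulerian_fps * ((fps_deriv ^^ u) \<Theta> + (fps_x + eulerian_tail) * \<beta>)"
    "if u = 0 then \<beta> = 0 else fps_cone (u - 1) \<beta>"
proof (induction u arbitrary: thesis)
  case 0
  show ?case by (rule 0[of 0]) (auto simp: mult.commute)
next
  case (Suc u)
  let ?C = eulerian_fps and ?T = eulerian_tail and ?\<alpha> = "(fps_deriv ^^ u) \<Theta>"
  \<comment> \<open>The sum of \<open>x + T\<close>, from the derivative of \<open>C\<close>, and
    \<open>1 + T\<close>, from that of \<open>T\<close>, regrouped into two summands that lie in the
    cone.\<close>
  let ?M = "(1 + fps_x + ?T) + ?T"
  obtain \<beta> where \<beta>: "(fps_deriv ^^ u) (\<Theta> * ?C) = ?C * (?\<alpha> + (fps_x + ?T) * \<beta>)"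
    "if u = 0 then \<beta> = 0 else fps_cone (u - 1) \<beta>"
    using Suc.IH by blast
  have "fps_cone 1 ?M"
    by (intro fps_cone_add fps_cone_linear_plus_eulerian_tail fps_cone_eulerian_tail)
  then have "fps_cone u (?M * \<beta>)"
    using \<beta>(2) fps_cone_0 fps_cone_mult[of 1 ?M "u - 1" \<beta>] by (cases "u = 0") auto
  moreover have "fps_cone u (fps_deriv \<beta>)"
    using \<beta>(2) fps_cone_0 fps_cone_deriv[of "u - 1" \<beta>] by (cases "u = 0") auto
  moreover have "fps_cone u ?\<alpha>"
    using fps_cone_deriv_pow[OF assms] by simp
  ultimately have "fps_cone u (?\<alpha> + ?M * \<beta> + fps_deriv \<beta>)"
    by (intro fps_cone_add)
  moreover have "(fps_deriv ^^ Suc u) (\<Theta> * ?C)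
      = ?C * ((fps_deriv ^^ Suc u) \<Theta> + (fps_x + ?T) * (?\<alpha> + ?M * \<beta> + fps_deriv \<beta>))"
    unfolding funpow.simps comp_def \<beta>(1)
    by (simp add: fps_deriv_eulerian fps_deriv_eulerian_tail algebra_simps)
  ultimately show ?case
    by (intro Suc.prems[of "?\<alpha> + ?M * \<beta> + fps_deriv \<beta>"]) simp_all
qed

text \<open>With \<open>B = e\<^sup>t C\<close>, the series
  \<open>B (\<alpha> + (x + T) \<beta>)\<close> is regrouped as
  \<open>(B \<alpha> + B T \<beta>) + x B \<beta>\<close>; the two parts have offsets
  \<open>u\<close> and \<open>u - 1\<close>.\<close>

lemma fps_decomposition:
  assumes "fps_cone 0 \<Theta>"
  obtains a b where "fps_nth (fps_e * (fps_deriv ^^ u) (\<Theta> * eulerian_fps)) v = a + [:0, 1:] * b"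
    "K (u + v) a" "if u + v = 0 then b = 0 else K (u + v - 1) b"
proof -
  let ?T = eulerian_tail and ?\<alpha> = "(fps_deriv ^^ u) \<Theta>" and ?B = "fps_e * eulerian_fps"
  obtain \<beta> where \<beta>: "(fps_deriv ^^ u) (\<Theta> * eulerian_fps) = eulerian_fps * (?\<alpha> + (fps_x + ?T) * \<beta>)"
    "if u = 0 then \<beta> = 0 else fps_cone (u - 1) \<beta>"
    using fps_deriv_pow_mult_eulerian[OF assms] by blast
  let ?a = "fps_nth (?B * ?\<alpha> + ?B * (?T * \<beta>)) v" and ?b = "fps_nth (?B * \<beta>) v"
  have "fps_cone (0 + u) (?B * ?\<alpha>)"
    using fps_cone_deriv_pow[OF assms, of u] fps_cone_binomial_eulerian
    by (intro fps_cone_mult) auto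
  moreover have "fps_cone (0 + u) (?B * (?T * \<beta>))"
  proof (cases "u = 0")
    case False
    then have "fps_cone (1 + (u - 1)) (?T * \<beta>)"
      using \<beta>(2) fps_cone_eulerian_tail by (intro fps_cone_mult) auto
    then show ?thesis
      using False fps_cone_binomial_eulerian by (intro fps_cone_mult) auto
  qed (use \<beta>(2) fps_cone_0 in auto)
  ultimately have "fps_cone (0 + u) (?B * ?\<alpha> + ?B * (?T * \<beta>))"
    by (rule fps_cone_add)
  then have "K (u + v) ?a"
    unfolding fps_cone_def by (metis add.commute add_0)
  moreover have "if u + v = 0 then ?b = 0 else K (u + v - 1) ?b"
  proof (cases "u = 0")
    case False
    then have "fps_cone (0 + (u - 1)) (?B * \<beta>)"
      using \<beta>(2) fps_cone_binomial_eulerian by (intro fps_cone_mult) auto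
    then have "K (v + (u - 1)) ?b"
      unfolding fps_cone_def by simp
    then show ?thesis using False by (simp add: add.commute)
  qed (use \<beta>(2) zero in auto)
  moreover have "fps_nth (fps_e * (fps_deriv ^^ u) (\<Theta> * eulerian_fps)) v = ?a + [:0, 1:] * ?b"
  proof -
    have "fps_e * (fps_deriv ^^ u) (\<Theta> * eulerian_fps)
      = (?B * ?\<alpha> + ?B * (?T * \<beta>)) + fps_x * (?B * \<beta>)"
      unfolding \<beta>(1) by (simp add: algebra_simps)
    then show ?thesis by (simp only: fps_x_def fps_add_nth fps_mult_left_const_nth)
  qed
  ultimately show ?thesis
    using that by blast
qed

end

section \<open>Gamma-positive and symmetric unimodal polynomials\<close>

text \<open>Both cones are nonnegative spans of such families, so closure under multiplication needs
  checking on the generators only.\<close>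

definition basis_cone :: "(nat \<Rightarrow> nat \<Rightarrow> real poly) \<Rightarrow> nat \<Rightarrow> real poly \<Rightarrow> bool" where
  "basis_cone \<beta> m p \<longleftrightarrow> (\<exists>\<gamma>. (\<forall>i\<le>m div 2. 0 \<le> \<gamma> i) \<and> p = (\<Sum>i\<le>m div 2. smult (\<gamma> i) (\<beta> m i)))"

lemma basis_cone_0: "basis_cone \<beta> m 0"
  unfolding basis_cone_def by (intro exI[of _ "\<lambda>_. 0"]) auto

lemma basis_cone_add:
  assumes "basis_cone \<beta> m p" "basis_cone \<beta> m q"
  shows "basis_cone \<beta> m (p + q)"
proof -
  obtain \<gamma> \<delta> where "\<forall>i\<le>m div 2. 0 \<le> \<gamma> i" "p = (\<Sum>i\<le>m div 2. smult (\<gamma> i) (\<beta> m i))"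
    "\<forall>i\<le>m div 2. 0 \<le> \<delta> i" "q = (\<Sum>i\<le>m div 2. smult (\<delta> i) (\<beta> m i))"
    using assms unfolding basis_cone_def by blast
  then show ?thesis
    unfolding basis_cone_def
    by (intro exI[of _ "\<lambda>i. \<gamma> i + \<delta> i"]) (auto simp: smult_add_left sum.distrib)
qed

lemma basis_cone_smult:
  assumes "0 \<le> c" "basis_cone \<beta> m p"
  shows "basis_cone \<beta> m (smult c p)"
proof -
  obtain \<gamma> where "\<forall>i\<le>m div 2. 0 \<le> \<gamma> i" "p = (\<Sum>i\<le>m div 2. smult (\<gamma> i) (\<beta> m i))"
    using assms unfolding basis_cone_def by blast
  then show ?thesis
    unfolding basis_cone_def using assms(1)
    by (intro exI[of _ "\<lambda>i. c * \<gamma> i"]) (auto simp: poly_eq_iff coeff_sum sum_distrib_left mult.assoc)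
qed

lemma basis_cone_sum: "(\<And>i. i \<in> A \<Longrightarrow> basis_cone \<beta> m (f i)) \<Longrightarrow> basis_cone \<beta> m (\<Sum>i\<in>A. f i)"
  by (induction A rule: infinite_finite_induct) (auto intro: basis_cone_0 basis_cone_add)

lemma basis_cone_basis:
  assumes "i \<le> m div 2"
  shows "basis_cone \<beta> m (\<beta> m i)"
proof -
  have "(\<Sum>j\<le>m div 2. smult (if j = i then 1 else 0) (\<beta> m j)) = (\<Sum>j\<le>m div 2. if j = i then \<beta> m j else 0)"
    by (intro sum.cong) auto
  then show ?thesis
    unfolding basis_cone_def using assms
    by (intro exI[of _ "\<lambda>j. if j = i then 1 else 0"]) auto
qed

lemma basis_cone_mult:
  assumes "\<And>i j. i \<le> a div 2 \<Longrightarrow> j \<le> b div 2 \<Longrightarrow> basis_cone \<beta> (a + b) (\<beta> a i * \<beta> b j)"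
    and "basis_cone \<beta> a p" "basis_cone \<beta> b q"
  shows "basis_cone \<beta> (a + b) (p * q)"
proof -
  obtain \<gamma> \<delta> where "\<forall>i\<le>a div 2. 0 \<le> \<gamma> i" "p = (\<Sum>i\<le>a div 2. smult (\<gamma> i) (\<beta> a i))"
    "\<forall>i\<le>b div 2. 0 \<le> \<delta> i" "q = (\<Sum>i\<le>b div 2. smult (\<delta> i) (\<beta> b i))"
    using assms(2,3) unfolding basis_cone_def by blast
  then show ?thesis
    by (auto simp: sum_product intro!: basis_cone_sum basis_cone_smult assms(1))
qed

lemma gamma_positive_eq_basis_cone:
  "gamma_positive = basis_cone (\<lambda>m i. monom 1 i * [:1, 1:] ^ (m - 2 * i))"
  by (intro ext) (simp add: gamma_positive_def basis_cone_def)

text \<open>The product of generators \<open>i\<close> and \<open>j\<close> is the generator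
  \<open>i + j\<close>: both the powers of \<open>x\<close> and the exponents of
  \<open>1 + x\<close> add up.\<close>

interpretation gamma_cone: poly_cone gamma_positive
proof
  let ?\<beta> = "\<lambda>m i. monom 1 i * [:1, 1:] ^ (m - 2 * i) :: real poly"
  fix m :: nat and p q :: "real poly"
  show "gamma_positive m 0"
    by (simp add: gamma_positive_eq_basis_cone basis_cone_0)
  show "gamma_positive m (p + q)" if "gamma_positive m p" "gamma_positive m q"
    using that by (simp add: gamma_positive_eq_basis_cone basis_cone_add)
  show "gamma_positive m (smult c p)" if "0 \<le> c" "gamma_positive m p" for c
    using that by (simp add: gamma_positive_eq_basis_cone basis_cone_smult)
  show "gamma_positive (a + b) (p * q)" if "gamma_positive a p" "gamma_positive b q" for a b
    using that unfolding gamma_positive_eq_basis_cone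
  proof (rule basis_cone_mult[rotated])
    fix i j assume "i \<le> a div 2" "j \<le> b div 2"
    then have "(a - 2 * i) + (b - 2 * j) = a + b - 2 * (i + j)" "i + j \<le> (a + b) div 2"
      by auto
    moreover from this(1) have "?\<beta> (a + b) (i + j)
        = monom 1 (i + j) * ([:1, 1:] ^ (a - 2 * i) * [:1, 1:] ^ (b - 2 * j))"
      by (simp flip: power_add)
    moreover have "monom 1 (i + j) = monom (1::real) i * monom 1 j"
      by (simp add: mult_monom)
    ultimately have "?\<beta> a i * ?\<beta> b j = ?\<beta> (a + b) (i + j)" "i + j \<le> (a + b) div 2"
      by (simp_all only: mult_ac)
    then show "basis_cone ?\<beta> (a + b) (?\<beta> a i * ?\<beta> b j)"
      using basis_cone_basis[of "i + j" "a + b" ?\<beta>] by simp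
  qed
  show "gamma_positive 0 1"
    using basis_cone_basis[of 0 0 ?\<beta>] by (simp add: gamma_positive_eq_basis_cone)
  show "gamma_positive 1 [:1, 1:]"
    using basis_cone_basis[of 0 1 ?\<beta>] by (simp add: gamma_positive_eq_basis_cone)
  show "gamma_positive 2 [:0, 1:]"
    using basis_cone_basis[of 1 2 ?\<beta>] by (simp add: gamma_positive_eq_basis_cone monom_altdef)
qed

section \<open>Symmetric polynomials\<close>

lemma symmetric_poly_0: "symmetric_poly m 0"
  by (simp add: symmetric_poly_def)

lemma symmetric_poly_add:
  "symmetric_poly m p \<Longrightarrow> symmetric_poly m q \<Longrightarrow> symmetric_poly m (p + q)"
  unfolding symmetric_poly_def coeff_add by (metis degree_add_le)

lemma symmetric_poly_smult: "symmetric_poly m p \<Longrightarrow> symmetric_poly m (smult c p)"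
  unfolding symmetric_poly_def coeff_smult by (metis degree_smult_le order_trans)

lemma symmetric_poly_sum:
  "(\<And>i. i \<in> A \<Longrightarrow> symmetric_poly m (f i)) \<Longrightarrow> symmetric_poly m (\<Sum>i\<in>A. f i)"
  by (induction A rule: infinite_finite_induct) (auto intro: symmetric_poly_0 symmetric_poly_add)

text \<open>Each generator is a row of binomial coefficients, shifted so that its midpoint is
  \<open>m / 2\<close>.\<close>

lemma gamma_positive_imp_symmetric:
  assumes "gamma_positive m p"
  shows "symmetric_poly m p"
proof -
  have "symmetric_poly m (monom 1 i * [:1, 1:] ^ (m - 2 * i))" if "i \<le> m div 2" for i
    unfolding symmetric_poly_def
  proof (intro conjI allI impI)
    have c: "coeff (monom 1 i * [:1, 1:] ^ (m - 2 * i)) k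
        = (if k < i then 0 else real ((m - 2 * i) choose (k - i)))" for k
    proof (cases "k - i \<le> m - 2 * i")
      case False
      then have "degree ([:1, 1::real:] ^ (m - 2 * i)) < k - i"
        using degree_power_le[of "[:1, 1::real:]" "m - 2 * i"] by simp
      then show ?thesis using False by (simp add: coeff_monom_mult coeff_eq_0 binomial_eq_0)
    qed (simp add: coeff_monom_mult coeff_linear_poly_power)
    show "degree (monom 1 i * [:1, 1::real:] ^ (m - 2 * i)) \<le> m"
      using that by (intro degree_le allI impI) (auto simp: c)
    fix k assume "k \<le> m"
    show "coeff (monom 1 i * [:1, 1::real:] ^ (m - 2 * i)) k = coeff (monom 1 i * [:1, 1:] ^ (m - 2 * i)) (m - k)"
    proof (cases "i \<le> k \<and> k \<le> m - i")
      case True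
      then have "(m - 2 * i) - (k - i) = m - k - i"
        using that by linarith
      then show ?thesis
        using True that binomial_symmetric[of "k - i" "m - 2 * i"] unfolding c by auto
    next
      case False
      then show ?thesis using that \<open>k \<le> m\<close> unfolding c by auto
    qed
  qed
  then show ?thesis
    using assms unfolding gamma_positive_def by (auto intro!: symmetric_poly_sum symmetric_poly_smult)
qed

section \<open>Strings \<open>1 + x + ... + x^c\<close> and the cone of symmetric unimodal
  polynomials\<close>

definition geom_poly :: "nat \<Rightarrow> real poly" where
  "geom_poly c = (\<Sum>j\<le>c. monom 1 j)"

lemma coeff_geom_poly: "coeff (geom_poly c) k = (if k \<le> c then 1 else 0)"
  by (simp add: geom_poly_def coeff_sum)

lemma geom_poly_0 [simp]: "geom_poly 0 = 1"
  by (simp add: geom_poly_def)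

lemma geom_poly_mult: "[:1, -1:] * geom_poly c = 1 - monom 1 (Suc c)"
proof (rule poly_eqI)
  fix k show "coeff ([:1, -1:] * geom_poly c) k = coeff (1 - monom 1 (Suc c)) k"
    by (cases k) (auto simp: coeff_geom_poly coeff_pCons)
qed

text \<open>A product rule for q-integers of Clebsch-Gordan type, checked after multiplication by
  \<open>(1 - x) * (1 - x)\<close>, which makes each string a binomial.\<close>

lemma geom_poly_Suc_mult:
  "geom_poly (Suc c) * geom_poly (Suc d) = geom_poly (Suc c + Suc d) + monom 1 1 * (geom_poly c * geom_poly d)"
proof -
  define x where "x = [:0, 1::real:]"
  have x: "[:1, -1:] = 1 - x"
    by (simp add: x_def one_pCons)
  have g: "(1 - x) * geom_poly c = 1 - x * x ^ c" for c
    using geom_poly_mult[of c] unfolding x by (simp add: monom_altdef x_def)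
  have "(1 - x) * (1 - x) * (geom_poly (Suc c) * geom_poly (Suc d))
      = ((1 - x) * geom_poly (Suc c)) * ((1 - x) * geom_poly (Suc d))"
    by (simp only: mult_ac)
  also have "\<dots> = (1 - x) * (1 - x * x ^ (Suc c + Suc d)) + x * ((1 - x * x ^ c) * (1 - x * x ^ d))"
    unfolding g by (simp add: algebra_simps power_add)
  also have "\<dots> = (1 - x) * ((1 - x) * geom_poly (Suc c + Suc d)) + x * (((1 - x) * geom_poly c) * ((1 - x) * geom_poly d))"
    unfolding g ..
  also have "\<dots> = (1 - x) * (1 - x) * (geom_poly (Suc c + Suc d) + x * (geom_poly c * geom_poly d))"
    by (simp only: distrib_left mult_ac)
  finally have "(1 - x) * (1 - x) * (geom_poly (Suc c) * geom_poly (Suc d))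
     = (1 - x) * (1 - x) * (geom_poly (Suc c + Suc d) + x * (geom_poly c * geom_poly d))" .
  moreover have "(1 - x) * (1 - x) \<noteq> 0"
    by (simp add: x[symmetric])
  ultimately have "geom_poly (Suc c) * geom_poly (Suc d) = geom_poly (Suc c + Suc d) + x * (geom_poly c * geom_poly d)"
    by (simp only: mult_cancel_left simp_thms)
  then show ?thesis by (simp add: x_def monom_altdef)
qed

text \<open>The string \<open>x^i + ... + x^(m - i)\<close>; symmetric unimodal polynomials are
  stacked from these horizontal layers.\<close>

definition unimodal_basis :: "nat \<Rightarrow> nat \<Rightarrow> real poly" where
  "unimodal_basis m i = monom 1 i * geom_poly (m - 2 * i)"

lemma coeff_unimodal_basis:
  "i \<le> m div 2 \<Longrightarrow> coeff (unimodal_basis m i) k = (if i \<le> k \<and> k \<le> m - i then 1 else 0)"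
  by (auto simp: unimodal_basis_def coeff_monom_mult coeff_geom_poly)

text \<open>Each use of the product rule splits off one string with center \<open>m / 2\<close> and
  shortens both factors, until one of them is 1.\<close>

lemma basis_cone_geom_mult: "i \<le> m div 2 \<Longrightarrow> c + d = m - 2 * i \<Longrightarrow>
   basis_cone unimodal_basis m (monom 1 i * (geom_poly c * geom_poly d))"
proof (induction c arbitrary: d i)
  case 0
  then show ?case
    using basis_cone_basis[OF 0(1), of unimodal_basis]
    by (simp add: unimodal_basis_def[of m])
next
  case (Suc c)
  show ?case
  proof (cases d)
    case 0
    then show ?thesis
      using basis_cone_basis[OF Suc.prems(1), of unimodal_basis] Suc.prems
      by (simp add: unimodal_basis_def[of m])
  next
    case (Suc d')
    have "monom 1 i * (geom_poly (Suc c) * geom_poly d)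
      = unimodal_basis m i + monom 1 (Suc i) * (geom_poly c * geom_poly d')"
    proof -
      have "monom 1 (Suc i) = monom 1 i * monom (1::real) 1"
        by (simp add: mult_monom)
      then show ?thesis
        unfolding Suc geom_poly_Suc_mult unimodal_basis_def Suc.prems(2)[symmetric, unfolded Suc]
        by (simp only: distrib_left mult_ac)
    qed
    moreover have "basis_cone unimodal_basis m (monom 1 (Suc i) * (geom_poly c * geom_poly d'))"
      using Suc.prems \<open>d = Suc d'\<close> by (intro Suc.IH) auto
    ultimately show ?thesis
      using basis_cone_add basis_cone_basis[OF Suc.prems(1), of unimodal_basis] by simp
  qed
qed

text \<open>The weight of layer \<open>i\<close> is the increment from coefficient
  \<open>i - 1\<close> to \<open>i\<close>; these weights are nonnegative up to the middle exactly
  when the coefficients increase from 0 up to there.\<close>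

lemma symmetric_unimodal_iff_basis_cone:
  "symmetric_poly m p \<and> unimodal p \<longleftrightarrow> basis_cone unimodal_basis m p"
proof (intro iffI conjI)
  assume "symmetric_poly m p \<and> unimodal p"
  then have deg: "degree p \<le> m" and sym: "\<And>i. i \<le> m \<Longrightarrow> coeff p i = coeff p (m - i)"
    and nonneg: "\<And>i. 0 \<le> coeff p i"
    and "\<exists>k. (\<forall>i<k. coeff p i \<le> coeff p (Suc i)) \<and> (\<forall>i\<ge>k. coeff p (Suc i) \<le> coeff p i)"
    unfolding symmetric_poly_def unimodal_def by blast+
  then obtain k where inc: "\<And>i. i < k \<Longrightarrow> coeff p i \<le> coeff p (Suc i)"
    and dec: "\<And>i. i \<ge> k \<Longrightarrow> coeff p (Suc i) \<le> coeff p i"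
    by blast
  \<comment> \<open>If the given peak is at or before \<open>i\<close>, the coefficients descend
    from \<open>Suc i\<close> to \<open>m - i\<close>, and by symmetry the last one equals
    coefficient \<open>i\<close>.\<close>
  have mono: "coeff p i \<le> coeff p (Suc i)" if "Suc i \<le> m div 2" for i
  proof (cases "i < k")
    case False
    have "coeff p j \<le> coeff p (Suc i)" if "Suc i \<le> j" for j
      using that False
    proof (induction j rule: dec_induct)
      case (step j)
      then show ?case using dec[of j] by fastforce
    qed simp
    from this[of "m - i"] show ?thesis
      using sym[of i] that by simp
  qed (rule inc)
  define \<gamma> where "\<gamma> i = coeff p i - (if i = 0 then 0 else coeff p (i - 1))" for i
  have tel: "(\<Sum>i\<le>k. \<gamma> i) = coeff p k" for k
    by (induction k) (auto simp: \<gamma>_def)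
  have "0 \<le> \<gamma> i" if "i \<le> m div 2" for i
    using that nonneg[of 0] mono[of "i - 1"] by (cases i) (auto simp: \<gamma>_def)
  moreover have "p = (\<Sum>i\<le>m div 2. smult (\<gamma> i) (unimodal_basis m i))"
  proof (rule poly_eqI)
    fix k
    have "coeff (\<Sum>i\<le>m div 2. smult (\<gamma> i) (unimodal_basis m i)) k
       = (\<Sum>i\<le>m div 2. if i \<le> k \<and> k \<le> m - i then \<gamma> i else 0)"
      unfolding coeff_sum by (intro sum.cong) (auto simp: coeff_unimodal_basis)
    also have "\<dots> = (\<Sum>i\<in>{i. i \<le> m div 2 \<and> i \<le> k \<and> k \<le> m - i}. \<gamma> i)"
      by (simp add: sum.If_cases Int_def)
    also have "\<dots> = coeff p k"
    \<comment> \<open>The layers covering exponent \<open>k\<close> are those up to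
      \<open>min k (m - k)\<close>; their weights telescope to the coefficient there, which by
      symmetry is that of \<open>k\<close>.\<close>
    proof (cases "k \<le> m")
      case True
      then have "{i. i \<le> m div 2 \<and> i \<le> k \<and> k \<le> m - i} = {..min k (m - k)}"
        by auto
      then show ?thesis
        using sym[OF True] by (simp add: tel min_def)
    next
      case False
      then have "{i. i \<le> m div 2 \<and> i \<le> k \<and> k \<le> m - i} = {}" by auto
      then show ?thesis using False deg by (simp only: sum.empty) (simp add: coeff_eq_0)
    qed
    finally show "coeff p k = coeff (\<Sum>i\<le>m div 2. smult (\<gamma> i) (unimodal_basis m i)) k" ..
  qed
  ultimately show "basis_cone unimodal_basis m p"
    unfolding basis_cone_def by blast
next
  assume "basis_cone unimodal_basis m p"
  then obtain \<gamma> where \<gamma>: "\<forall>i\<le>m div 2. 0 \<le> \<gamma> i" and p: "p = (\<Sum>i\<le>m div 2. smult (\<gamma> i) (unimodal_basis m i))"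
    unfolding basis_cone_def by blast
  have "symmetric_poly m (unimodal_basis m i)" if "i \<le> m div 2" for i
    unfolding symmetric_poly_def using that
    by (auto intro!: degree_le simp: coeff_unimodal_basis)
  then show sym: "symmetric_poly m p"
    unfolding p by (auto intro!: symmetric_poly_sum symmetric_poly_smult)
  have c: "coeff p k = (\<Sum>i\<le>m div 2. \<gamma> i * (if i \<le> k \<and> k \<le> m - i then 1 else 0))" for k
    unfolding p coeff_sum by (intro sum.cong) (auto simp: coeff_unimodal_basis)
  show "unimodal p"
    unfolding unimodal_def c
  proof (intro conjI allI exI[of _ "m div 2"] impI)
    fix i
    show "0 \<le> (\<Sum>j\<le>m div 2. \<gamma> j * (if j \<le> i \<and> i \<le> m - j then 1 else 0))"
      using \<gamma> by (intro sum_nonneg) auto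
    show "(\<Sum>j\<le>m div 2. \<gamma> j * (if j \<le> i \<and> i \<le> m - j then 1 else 0))
       \<le> (\<Sum>j\<le>m div 2. \<gamma> j * (if j \<le> Suc i \<and> Suc i \<le> m - j then 1 else 0))" if "i < m div 2"
      using \<gamma> that by (intro sum_mono mult_left_mono) auto
    show "(\<Sum>j\<le>m div 2. \<gamma> j * (if j \<le> Suc i \<and> Suc i \<le> m - j then 1 else 0))
       \<le> (\<Sum>j\<le>m div 2. \<gamma> j * (if j \<le> i \<and> i \<le> m - j then 1 else 0))" if "m div 2 \<le> i"
      using \<gamma> that by (intro sum_mono mult_left_mono) auto
  qed
qed

text \<open>Unimodality alone is not closed under addition; a common center of symmetry repairs
  this. Products reduce to products of strings.\<close>

interpretation unimodal_cone: poly_cone "\<lambda>m p. symmetric_poly m p \<and> unimodal p"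
  unfolding symmetric_unimodal_iff_basis_cone
proof
  fix m :: nat and p q :: "real poly"
  show "basis_cone unimodal_basis (a + b) (p * q)"
    if "basis_cone unimodal_basis a p" "basis_cone unimodal_basis b q" for a b
    using that
  proof (rule basis_cone_mult[rotated])
    fix i j assume "i \<le> a div 2" "j \<le> b div 2"
    then have "(a - 2 * i) + (b - 2 * j) = a + b - 2 * (i + j)" "i + j \<le> (a + b) div 2"
      by auto
    then have "basis_cone unimodal_basis (a + b) (monom 1 (i + j) * (geom_poly (a - 2 * i) * geom_poly (b - 2 * j)))"
      by (intro basis_cone_geom_mult)
    moreover have "monom 1 (i + j) = monom (1::real) i * monom 1 j"
      by (simp add: mult_monom)
    ultimately show "basis_cone unimodal_basis (a + b) (unimodal_basis a i * unimodal_basis b j)"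
      unfolding unimodal_basis_def by (simp only: mult_ac)
  qed
  show "basis_cone unimodal_basis 0 1"
    using basis_cone_basis[of 0 0 unimodal_basis] by (simp add: unimodal_basis_def geom_poly_def)
  show "basis_cone unimodal_basis 1 [:1, 1:]"
    using basis_cone_basis[of 0 1 unimodal_basis]
    by (simp add: unimodal_basis_def geom_poly_def monom_altdef one_pCons)
  show "basis_cone unimodal_basis 2 [:0, 1:]"
    using basis_cone_basis[of 1 2 unimodal_basis]
    by (simp add: unimodal_basis_def geom_poly_def monom_altdef)
qed (auto intro: basis_cone_0 basis_cone_add basis_cone_smult)

section \<open>Symmetric decompositions of binomial sums\<close>

lemma fps_nth_deriv_pow:
  fixes F :: "real poly fps"
  shows "fps_nth ((fps_deriv ^^ u) F) j = smult (fact (u + j) / fact j) (fps_nth F (u + j))"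
proof (induction u arbitrary: j)
  case (Suc u)
  have "fps_nth ((fps_deriv ^^ Suc u) F) j = smult (real (Suc j)) (fps_nth ((fps_deriv ^^ u) F) (Suc j))"
    by (simp add: of_nat_poly del: of_nat_Suc)
  also have "\<dots> = smult (real (Suc j) * (fact (u + Suc j) / fact (Suc j))) (fps_nth F (u + Suc j))"
    by (simp only: Suc.IH smult_smult)
  also have "real (Suc j) * (fact (u + Suc j) / fact (Suc j)) = fact (Suc u + j) / fact j"
    by (simp add: field_simps del: of_nat_Suc)
  finally show ?case by simp
qed simp

text \<open>On exponential generating functions, \<open>u\<close> derivatives shift the sequence by
  \<open>u\<close> and multiplication by \<open>fps_e\<close> is the binomial transform.\<close>

lemma fps_e_mult_deriv_pow_nth:
  assumes "\<And>m. m \<le> u + v \<Longrightarrow> fps_nth F m = smult (1 / fact m) (g m)"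
  shows "smult (fact v) (fps_nth (fps_e * (fps_deriv ^^ u) F) v) = (\<Sum>j\<le>v. smult (real (v choose j)) (g (u + j)))"
proof -
  have "fps_nth (fps_e * (fps_deriv ^^ u) F) v = (\<Sum>j\<le>v. fps_nth ((fps_deriv ^^ u) F) j * fps_nth fps_e (v - j))"
    by (subst mult.commute) (simp only: fps_mult_nth atLeast0AtMost)
  also have "\<dots> = (\<Sum>j\<le>v. smult (1 / (fact j * fact (v - j))) (g (u + j)))"
    using assms by (intro sum.cong) (simp_all add: fps_nth_deriv_pow fps_e_def mult.commute)
  finally have "smult (fact v) (fps_nth (fps_e * (fps_deriv ^^ u) F) v)
      = (\<Sum>j\<le>v. smult (fact v * (1 / (fact j * fact (v - j)))) (g (u + j)))"
    by (simp add: poly_eq_iff coeff_sum sum_distrib_left mult.assoc)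
  also have "\<dots> = (\<Sum>j\<le>v. smult (real (v choose j)) (g (u + j)))"
    by (intro sum.cong) (simp_all add: binomial_fact)
  finally show ?thesis .
qed

text \<open>In exponential generating functions, the recurrence expressing theta polynomials through
  interior h-polynomials is multiplication by \<open>1 - boundary_fps\<close>.\<close>

lemma fps_nth_mult_eulerian:
  fixes g \<theta> :: "nat \<Rightarrow> real poly"
  assumes "\<And>m. m \<le> n \<Longrightarrow>
      \<theta> m = g m - [:0, 1:] * (\<Sum>k<m. smult (real (m choose k)) ([:1, -1:] ^ (m - 1 - k) * g k))"
    and "\<And>m. m \<le> n \<Longrightarrow> fps_nth \<Theta> m = smult (1 / fact m) (\<theta> m)"
    and "w \<le> n"
  shows "fps_nth (\<Theta> * eulerian_fps) w = smult (1 / fact w) (g w)"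
proof -
  define G where "G = Abs_fps (\<lambda>m. smult (1 / fact m) (g m))"
  \<comment> \<open>Agreement up to index \<open>n\<close> is enough, since coefficient
    \<open>w\<close> of a product involves only coefficients up to \<open>w\<close>.\<close>
  have \<Theta>: "fps_nth ((1 - boundary_fps) * G) m = fps_nth \<Theta> m" if "m \<le> n" for m
  proof -
    have "fps_nth (G * boundary_fps) m = (\<Sum>k\<le>m. fps_nth G k * fps_nth boundary_fps (m - k))"
      by (simp only: fps_mult_nth atLeast0AtMost)
    \<comment> \<open>The term \<open>k = m\<close> drops out because \<open>boundary_fps\<close>
      has no constant term.\<close>
    also have "\<dots> = (\<Sum>k<m. fps_nth G k * fps_nth boundary_fps (m - k))"
      by (intro sum.mono_neutral_right) (auto simp: boundary_fps_def)
    also have "\<dots> = (\<Sum>k<m. smult (1 / fact m) ([:0, 1:] * smult (real (m choose k)) ([:1, -1:] ^ (m - 1 - k) * g k)))"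
    proof (rule sum.cong)
      fix k assume "k \<in> {..<m}"
      then have k: "k < m" "m - 1 - k = m - k - 1" by auto
      have "1 / fact k * (1 / fact (m - k)) = 1 / fact m * real (m choose k)"
        using k(1) by (simp add: binomial_fact)
      moreover have "fps_nth G k * fps_nth boundary_fps (m - k)
          = smult (1 / fact k * (1 / fact (m - k))) ([:0, 1:] * ([:1, -1:] ^ (m - k - 1) * g k))"
        using k(1) by (simp add: G_def boundary_fps_def mult_ac del: mult_pCons_left mult_pCons_right)
      ultimately show "fps_nth G k * fps_nth boundary_fps (m - k)
          = smult (1 / fact m) ([:0, 1:] * smult (real (m choose k)) ([:1, -1:] ^ (m - 1 - k) * g k))"
        unfolding k(2) by (simp only: mult_smult_right smult_smult)
    qed simp
    also have "\<dots> = smult (1 / fact m) ([:0, 1:] * (\<Sum>k<m. smult (real (m choose k)) ([:1, -1:] ^ (m - 1 - k) * g k)))"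
      unfolding sum_distrib_left
      by (simp only: poly_eq_iff coeff_sum coeff_smult sum_distrib_left simp_thms)
    finally have "fps_nth (G * boundary_fps) m
        = smult (1 / fact m) ([:0, 1:] * (\<Sum>k<m. smult (real (m choose k)) ([:1, -1:] ^ (m - 1 - k) * g k)))" .
    moreover have "(1 - boundary_fps) * G = G - G * boundary_fps"
      by (simp add: algebra_simps)
    ultimately show ?thesis
      using assms(1,2)[OF that] by (simp add: G_def smult_diff_right del: mult_pCons_left)
  qed
  have "fps_nth (\<Theta> * eulerian_fps) w = (\<Sum>i=0..w. fps_nth \<Theta> i * fps_nth eulerian_fps (w - i))"
    by (rule fps_mult_nth)
  also have "\<dots> = (\<Sum>i=0..w. fps_nth ((1 - boundary_fps) * G) i * fps_nth eulerian_fps (w - i))"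
    using \<Theta> assms(3) by (intro sum.cong) auto
  also have "\<dots> = fps_nth ((1 - boundary_fps) * G * eulerian_fps) w"
    by (rule fps_mult_nth[symmetric])
  also have "(1 - boundary_fps) * G * eulerian_fps = G * (eulerian_fps * (1 - boundary_fps))"
    by (simp only: mult_ac)
  also have "\<dots> = G"
    by (simp only: eulerian_fps_inverse mult_1_right)
  finally show ?thesis by (simp add: G_def)
qed

context poly_cone
begin

text \<open>\<open>fps_decomposition\<close> for sequences: the binomial sum is
  \<open>fact v\<close> times a coefficient of the series treated there.\<close>

theorem binomial_sum_decomposition:
  assumes "\<And>m. m \<le> u + v \<Longrightarrow>
      \<theta> m = g m - [:0, 1:] * (\<Sum>k<m. smult (real (m choose k)) ([:1, -1:] ^ (m - 1 - k) * g k))"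
    and "\<And>m. m \<le> u + v \<Longrightarrow> K m (\<theta> m)"
  obtains a b where "(\<Sum>j\<le>v. smult (real (v choose j)) (g (u + j))) = a + [:0, 1:] * b"
    "K (u + v) a" "if u + v = 0 then b = 0 else K (u + v - 1) b"
proof -
  \<comment> \<open>The series is cut off after index \<open>u + v\<close>, beyond which nothing is
    known about \<open>\<theta>\<close>; zero coefficients keep it in the cone.\<close>
  define \<Theta> where "\<Theta> = Abs_fps (\<lambda>m. if m \<le> u + v then smult (1 / fact m) (\<theta> m) else 0)"
  have "fps_cone 0 \<Theta>"
    unfolding fps_cone_def \<Theta>_def using assms(2) by (auto intro!: zero smult)
  then obtain a b where ab: "fps_nth (fps_e * (fps_deriv ^^ u) (\<Theta> * eulerian_fps)) v = a + [:0, 1:] * b"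
    "K (u + v) a" "if u + v = 0 then b = 0 else K (u + v - 1) b"
    using fps_decomposition by blast
  have "fps_nth (\<Theta> * eulerian_fps) m = smult (1 / fact m) (g m)" if "m \<le> u + v" for m
    by (rule fps_nth_mult_eulerian[OF assms(1) _ that]) (simp_all add: \<Theta>_def)
  then have "(\<Sum>j\<le>v. smult (real (v choose j)) (g (u + j))) = smult (fact v) (a + [:0, 1:] * b)"
    using fps_e_mult_deriv_pow_nth[of u v "\<Theta> * eulerian_fps" g] by (simp only: ab(1))
  also have "\<dots> = smult (fact v) a + [:0, 1:] * smult (fact v) b"
    by (simp add: smult_add_right)
  finally show ?thesis
    using ab(2,3) by (intro that[of "smult (fact v) a" "smult (fact v) b"]) (auto intro: smult)
qed

end

section \<open>The linear map on the polynomials \<open>x^u (1 + x)^v\<close> and the final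
  assembly\<close>

lemma H_circ_sum: "H_circ V s \<Gamma> r (\<Sum>i\<in>A. p i) = (\<Sum>i\<in>A. H_circ V s \<Gamma> r (p i))"
  by (induction A rule: infinite_finite_induct) (simp_all add: H_circ_add, simp_all add: H_circ_def)

lemma H_circ_monom_mult_binomial:
  assumes "u + v \<le> card V"
  shows "H_circ V s \<Gamma> r (monom 1 u * [:1, 1:] ^ v)
    = (\<Sum>j\<le>v. smult (real (v choose j)) (reverse_poly (u + j) (h_simplex V s \<Gamma> r (u + j))))"
proof -
  have "[:1, 1:] = monom 1 1 + (1 :: real poly)" by (simp add: monom_altdef one_pCons)
  then have "[:1, 1:] ^ v = (\<Sum>j\<le>v. of_nat (v choose j) * monom (1::real) 1 ^ j * 1 ^ (v - j))"
    by (simp only: binomial_ring)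
  also have "\<dots> = (\<Sum>j\<le>v. smult (real (v choose j)) (monom 1 j))"
    by (simp add: of_nat_poly monom_power)
  finally have "monom 1 u * [:1, 1:] ^ v = (\<Sum>j\<le>v. smult (real (v choose j)) (monom 1 (u + j)))"
    by (simp add: sum_distrib_left mult_monom)
  then show ?thesis
    using assms by (simp add: H_circ_sum H_circ_smult H_circ_monom)
qed

context poly_cone
begin

text \<open>By uniformity the recurrence between theta and interior h-polynomials is one between
  sequences indexed by cardinality. \<open>binomial_sum_decomposition\<close> with
  \<open>u = n - k\<close> and \<open>v = k\<close> then treats each generator of
  \<open>P_polys n\<close>, and nonnegative combinations stay in the cones.\<close>

theorem H_circ_decomposition:
  assumes "finite V" "card V = n" "triangulation_of_simplex V s \<Gamma> r" "uniform_with_f_triangle V s \<Gamma> r f"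
    and K: "\<And>F. F \<subseteq> V \<Longrightarrow> K (card F) (theta_poly s \<Gamma> r F)"
    and p: "p \<in> P_polys n"
  obtains a b where "H_circ V s \<Gamma> r p = a + monom 1 1 * b" "K n a" "if n = 0 then b = 0 else K (n - 1) b"
proof -
  interpret simplex_triangulation V s \<Gamma> r
    using assms by unfold_locales
  define g where "g m = reverse_poly m (h_simplex V s \<Gamma> r m)" for m
  have g: "interior_h F = g (card F)" if "F \<subseteq> V" for F
    using reverse_h_poly_res[OF that] h_simplex_eq[OF assms(3,4) that] by (simp add: g_def)
  define \<theta> where "\<theta> m = g m - [:0, 1:] * (\<Sum>k<m. smult (real (m choose k)) ([:1, -1:] ^ (m - 1 - k) * g k))" for m
  have \<theta>: "theta_poly s \<Gamma> r F = \<theta> (card F)" if F: "F \<subseteq> V" for F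
  proof (cases "F = {}")
    case True
    then show ?thesis using g[of "{}"] interior_h_empty by (simp add: \<theta>_def theta_poly_def)
  next
    case False
    have "h_poly (bd F) = (\<Sum>E | E \<subset> F. [:1, -1:] ^ (card F - 1 - card E) * g (card E))"
      unfolding h_poly_bd_sum[OF F False] using F by (intro sum.cong) (auto simp: g)
    then show ?thesis
      unfolding theta_poly_eq[OF F False] g[OF F] \<theta>_def
      using sum_psubsets_by_card[OF finite_sub[OF F], of "\<lambda>k. [:1, -1:] ^ (card F - 1 - k) * g k"] by simp
  qed
  \<comment> \<open>Every \<open>m \<le> n\<close> is the cardinality of some face, so the
    hypothesis on faces reaches the whole sequence.\<close>
  have K\<theta>: "K m (\<theta> m)" if "m \<le> n" for m
  proof -
    have "m \<le> card V" using that assms(2) by simp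
    then obtain F where "F \<subseteq> V" "card F = m"
      by (rule obtain_subset_with_card_n)
    then show ?thesis using K[of F] \<theta>[of F] by simp
  qed
  have "\<exists>a b. H_circ V s \<Gamma> r (monom 1 (n - k) * [:1, 1:] ^ k) = a + [:0, 1:] * b
      \<and> K n a \<and> (if n = 0 then b = 0 else K (n - 1) b)" if "k \<le> n" for k
  proof -
    have n: "n - k + k = n" using that by simp
    obtain a b where "(\<Sum>j\<le>k. smult (real (k choose j)) (g (n - k + j))) = a + [:0, 1:] * b"
      "K n a" "if n = 0 then b = 0 else K (n - 1) b"
      using binomial_sum_decomposition[of "n - k" k \<theta> g, unfolded n, OF \<theta>_def K\<theta>] by blast
    moreover have "H_circ V s \<Gamma> r (monom 1 (n - k) * [:1, 1:] ^ k) = (\<Sum>j\<le>k. smult (real (k choose j)) (g (n - k + j)))"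
      unfolding g_def using that assms(2) by (intro H_circ_monom_mult_binomial) simp
    ultimately show ?thesis by (intro exI[of _ a] exI[of _ b]) simp
  qed
  then obtain a b where ab: "\<And>k. k \<le> n \<Longrightarrow> H_circ V s \<Gamma> r (monom 1 (n - k) * [:1, 1:] ^ k) = a k + [:0, 1:] * b k"
    "\<And>k. k \<le> n \<Longrightarrow> K n (a k)" "\<And>k. k \<le> n \<Longrightarrow> if n = 0 then b k = 0 else K (n - 1) (b k)"
    by metis
  obtain c where c: "\<And>k. k \<le> n \<Longrightarrow> 0 \<le> c k"
    and pc: "p = (\<Sum>k\<le>n. smult (c k) (monom 1 (n - k) * [:1, 1:] ^ k))"
    using p unfolding P_polys_def by blast
  have "H_circ V s \<Gamma> r p = (\<Sum>k\<le>n. smult (c k) (a k + [:0, 1:] * b k))"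
    unfolding pc H_circ_sum H_circ_smult using ab(1) by (intro sum.cong) simp_all
  also have "\<dots> = (\<Sum>k\<le>n. smult (c k) (a k)) + monom 1 1 * (\<Sum>k\<le>n. smult (c k) (b k))"
    by (simp add: smult_add_right sum.distrib sum_distrib_left monom_altdef)
  finally show ?thesis
  proof (rule that)
    show "K n (\<Sum>k\<le>n. smult (c k) (a k))"
      using ab(2) c by (intro sum smult) auto
    show "if n = 0 then (\<Sum>k\<le>n. smult (c k) (b k)) = 0 else K (n - 1) (\<Sum>k\<le>n. smult (c k) (b k))"
      using ab(3) c by (cases "n = 0") (auto intro!: sum smult)
  qed
qed

end

theorem theorem1p2:
  fixes V :: "'a set" and s :: "'a \<Rightarrow> 'e::euclidean_space"
    and \<Gamma> :: "'b set set" and r :: "'b \<Rightarrow> 'e"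
    and f :: "nat \<Rightarrow> nat \<Rightarrow> nat" and n :: nat
  assumes "finite V" and "card V = n"
    and "triangulation_of_simplex V s \<Gamma> r"
    and "uniform_with_f_triangle V s \<Gamma> r f"
  shows "(theta_unimodal V s \<Gamma> r \<longrightarrow>
            (\<forall>p\<in>P_polys n. has_unimodal_symmetric_decomposition n (H_circ V s \<Gamma> r p))) \<and>
         (theta_gamma_positive V s \<Gamma> r \<longrightarrow>
            (\<forall>p\<in>P_polys n. has_gamma_positive_symmetric_decomposition n (H_circ V s \<Gamma> r p)))"
proof (intro conjI impI ballI)
  interpret simplex_triangulation V s \<Gamma> r
    using assms by unfold_locales
  fix p assume p: "p \<in> P_polys n"
  show "has_unimodal_symmetric_decomposition n (H_circ V s \<Gamma> r p)" if "theta_unimodal V s \<Gamma> r"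
  proof -
    \<comment> \<open>The theta hypothesis gives unimodality only;
      \<open>symmetric_theta_poly\<close> supplies the center required by the cone.\<close>
    have K: "symmetric_poly (card F) (theta_poly s \<Gamma> r F) \<and> unimodal (theta_poly s \<Gamma> r F)"
      if "F \<subseteq> V" for F
      using symmetric_theta_poly[OF that] \<open>theta_unimodal V s \<Gamma> r\<close> that
      by (simp add: theta_unimodal_def)
    obtain a b where "H_circ V s \<Gamma> r p = a + monom 1 1 * b" "symmetric_poly n a \<and> unimodal a"
      "if n = 0 then b = 0 else symmetric_poly (n - 1) b \<and> unimodal b"
      using unimodal_cone.H_circ_decomposition[OF assms K p] by blast
    \<comment> \<open>For \<open>n = 0\<close> the part \<open>b\<close> is zero, and the zero
      polynomial is unimodal.\<close>
    then show ?thesis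
      unfolding has_unimodal_symmetric_decomposition_def symmetric_decomposition_def
      using unimodal_cone.zero by (intro exI[of _ a] exI[of _ b]) (auto split: if_splits)
  qed
  show "has_gamma_positive_symmetric_decomposition n (H_circ V s \<Gamma> r p)" if "theta_gamma_positive V s \<Gamma> r"
  proof -
    have K: "gamma_positive (card F) (theta_poly s \<Gamma> r F)" if "F \<subseteq> V" for F
      using \<open>theta_gamma_positive V s \<Gamma> r\<close> that by (simp add: theta_gamma_positive_def)
    obtain a b where "H_circ V s \<Gamma> r p = a + monom 1 1 * b" "gamma_positive n a"
      "if n = 0 then b = 0 else gamma_positive (n - 1) b"
      using gamma_cone.H_circ_decomposition[OF assms K p] by blast
    \<comment> \<open>The required symmetry of both parts follows from gamma-positivity; for
      \<open>n = 0\<close> the zero polynomial lies in the cone of grade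
      \<open>n - 1 = 0\<close>.\<close>
    then show ?thesis
      unfolding has_gamma_positive_symmetric_decomposition_def symmetric_decomposition_def
      using gamma_cone.zero gamma_positive_imp_symmetric
      by (intro exI[of _ a] exI[of _ b]) (auto split: if_splits)
  qed
qed

end
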